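(* Let $x=[[b_1,\ldots,b_s,\overline{c_1,\ldots,c_\ell}]]\in\mathbb R_{\rm C}^1$ have an eventually periodic code, put $M_{c_1}\cdots M_{c_\ell}=\begin{pmatrix}A&B\\C&D\end{pmatrix}$ over $\mathbb F_2[q]$, and assume that the polynomial $CY^2+(A+D)Y+B$ splits over $\mathbb F_2(q)$ (equivalently $\frac{BC}{(A+D)^2}\in\{u^2+u:u\in\mathbb F_2(q)\}$). Write its unique root in $1+q\mathbb F_2[[q]]$ in lowest terms as $Y=P/Q$, and put $$M_{b_1}\cdots M_{b_s}=\begin{pmatrix}A_0&B_0\\C_0&D_0\end{pmatrix},\qquad N:=A_0P+B_0Q,\quad\Delta:=C_0P+D_0Q.$$ Then $\Phi_2(x)=N/\Delta$, and $$\text{(a)}\quad \Phi_2(x)\in\mathbb F_2[q]\iff\Delta\mid N,$$ $$\text{(b)}\quad \Phi_2(x)\in H_2+\mathbb F_2[q]\iff(1-q)\Delta\mid\Delta+(1-q)N.$$ For a terminating code $(b_1,\ldots,b_s,\infty)$ the same formulas hold with $P=1$ and $Q=1+q$. These tests are exhaustive: if $\Phi_2(x)\in \mathbb F_2[q]$ or $\Phi_2(x)\in H_2+\mathbb F_2[q]$ for $x\in\mathbb R_{\rm C}^1$, then the code of $x$ is terminating, or is eventually periodic, $x=[[b_1,\ldots,b_s,\overline{c_1,\ldots,c_\ell}]]$, and such that, with $M_{c_1}\cdots M_{c_\ell}=\begin{pmatrix}A&B\\C&D\end{pmatrix}$ over $\mathbb F_2[q]$, the polynomial $CY^2+(A+D)Y+B$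 splits over $\mathbb F_2(q)$. The criteria extend from $\mathbb R_{\rm C}^1$ to $\mathbb R_{\rm C}^+$: for $x\in\mathbb R^+_{\rm C}\setminus\mathbb R^1_{\rm C}$, $\Phi_2(x)\in\mathbb F_2[q]$ (respectively $\in H_2+\mathbb F_2[q]$) if and only if the same holds for $x+1\in\mathbb R_{\rm C}^1$. In particular, for real $x\ge0$ write $[x]_q=\sum_{j\ge0}\gamma_jq^j$. The coefficients $\gamma_j$ are eventually even exactly when the criterion (a) holds, and eventually odd exactly when the criterion (b) holds (a rational $x$ being identified with the point $x_+$, and the criteria being applied to $x+1$ if $x<1$). For $x=r_-$ the same statement applies to the coefficients of $[x]_q^-$ $(:=[r]_q^-)$.
   Context: The Cantor line is $\mathbb R_{\rm C}:=(\mathbb R\setminus\mathbb Q)\sqcup\mathbb Q_+\sqcup\mathbb Q_-\sqcup\{-\infty,+\infty\}$, each rational $r$ being doubled into $r_-<r_+$, ordered in the evident way; $\mathbb R_{\rm C}^+:=[0_+,+\infty]$, $\mathbb R_{\rm C}^1:=[1_+,+\infty]$; integer translations act in the evident way. Points of $\mathbb R_{\rm C}^1$ correspond bijectively to codes, which are either infinite sequences of integers $\ge2$ or finite (possibly empty) sequences of integers $\ge2$ followed by $\infty$ (terminating codes): $+\infty$ has code $(\infty)$; $1_+$ has code $(2,2,\ldots)$; if $r=[[c_1,\ldots,c_N]]:=c_1-\frac1{c_2-\cdots\frac1{c_N}}>1$, $c_i\ge2$, then $r_-$ has code $(c_1,\ldots,c_N,\infty)$ and $r_+$ has code $(c_1,\ldots,c_{N-1},c_N+1,2,2,\ldots)$;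 an irrational $x>1$ has as code the digits $c_j\ge2$ of its infinite expansion $c_1-\frac1{c_2-\cdots}$. $[[\ldots]]$ denotes the point with the given code; an overline denotes periodic repetition. $[n]_q=\frac{1-q^n}{1-q}$. For real $x\ge1$ with infinite expansion $(c_1,c_2,\ldots)$, $c_j\ge 2$, $[x]_q\in\mathbb Z[[q]]$ is the $q$-adic limit of $[c_1]_q-\frac{q^{c_1-1}}{[c_2]_q-\cdots\frac{q^{c_{N-1}-1}}{[c_N]_q}}$, extended to all real $x$ by $[x+1]_q=q[x]_q+1$. For rational $r=[[c_1,\ldots,c_N]]>1$, $[r]_q^-$ is the same finite expression with last entry $[c_N]_q$ replaced by $[c_N]_q-q^{c_N-1}(1-q)$, extended to all $r\in\mathbb Q$ by $[r+1]^-_q=q[r]_q^-+1$. $\Phi_2$ is coefficientwise reduction mod 2: $\Phi_2(x)=[x]_q\bmod2$ for $x$ irrational, $\Phi_2(r_+)=[r]_q\bmod 2$, $\Phi_2(r_-)=[r]_q^-\bmod2$, $\Phi_2(+\infty)=H_2$, $\Phi_2(-\infty)=\infty$, where $H_2:=(1-q)^{-1}\in\mathbb F_2[[q]]$. $M_a=M_a(q):=\begin{pmatrix}[a]_q&q^{a-1}\\1&0\end{pmatrix}\in\mathrm{Mat}_2(\mathbb F_2[q])$; an empty product ($s=0$) is the identity matrix. *)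

theory Defs
  imports
    "HOL-Analysis.Analysis"
    "HOL-Computational_Algebra.Computational_Algebra"
    "HOL-Library.Z2"
    "HOL-Library.Stream"
begin

section \<open>The Cantor line\<close>

typedef irrational = "{x::real. x \<notin> \<rat>}"
  morphisms real_of_irrational Irrational
proof -
  have "\<exists>x::real. x \<notin> \<rat>"
    using uncountable_UNIV_real countable_rat by (metis UNIV_eq_I)
  then show ?thesis by blast
qed

datatype cantor_line =
  NegInf | PosInf | RatMinus rat | RatPlus rat | Irr irrational

text \<open>The order compares the underlying extended reals first; the two copies of a
  rational are then separated by the second component.\<close>

fun cl_val :: "cantor_line \<Rightarrow> ereal" where
  "cl_val NegInf = -\<infinity>"
| "cl_val PosInf = \<infinity>"
| "cl_val (RatMinus r) = ereal (of_rat r)"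
| "cl_val (RatPlus r) = ereal (of_rat r)"
| "cl_val (Irr x) = ereal (real_of_irrational x)"

fun cl_side :: "cantor_line \<Rightarrow> int" where
  "cl_side (RatMinus r) = -1"
| "cl_side (RatPlus r) = 1"
| "cl_side _ = 0"

lemma of_rat_neq_irrational: "of_rat r \<noteq> real_of_irrational x"
  using real_of_irrational[of x] by (metis Rats_of_rat mem_Collect_eq)

lemma cl_eqI: "cl_val x = cl_val y \<Longrightarrow> cl_side x = cl_side y \<Longrightarrow> x = y"
  by (cases x; cases y)
     (auto simp: real_of_irrational_inject of_rat_neq_irrational of_rat_neq_irrational[symmetric])

instantiation cantor_line :: linorder
begin

definition less_eq_cantor_line :: "cantor_line \<Rightarrow> cantor_line \<Rightarrow> bool" where
  "x \<le> y \<longleftrightarrow> cl_val x < cl_val y \<or> cl_val x = cl_val y \<and> cl_side x \<le> cl_side y"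

definition less_cantor_line :: "cantor_line \<Rightarrow> cantor_line \<Rightarrow> bool" where
  "x < y \<longleftrightarrow> cl_val x < cl_val y \<or> cl_val x = cl_val y \<and> cl_side x < cl_side y"

instance
  by standard (auto simp: less_eq_cantor_line_def less_cantor_line_def intro: cl_eqI)

end

definition RC_plus :: "cantor_line set" where
  "RC_plus = {RatPlus 0 .. PosInf}"

definition RC_one :: "cantor_line set" where
  "RC_one = {RatPlus 1 .. PosInf}"

fun translate :: "int \<Rightarrow> cantor_line \<Rightarrow> cantor_line" where
  "translate n NegInf = NegInf"
| "translate n PosInf = PosInf"
| "translate n (RatMinus r) = RatMinus (r + of_int n)"
| "translate n (RatPlus r) = RatPlus (r + of_int n)"
| "translate n (Irr x) = Irr (Irrational (real_of_irrational x + of_int n))"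

text \<open>A real number as a point of the Cantor line, a rational $r$ being read as $r_+$.\<close>

definition cantor_of_real :: "real \<Rightarrow> cantor_line" where
  "cantor_of_real x =
     (if x \<in> \<rat> then RatPlus (THE r. of_rat r = x) else Irr (Irrational x))"


section \<open>Negative continued fractions and codes\<close>

text \<open>\<open>hj [c\<^sub>1, \<dots>, c\<^sub>N]\<close> is $c_1 - 1/(c_2 - \cdots 1/c_N)$; the value on the empty
  list is irrelevant.\<close>

fun hj :: "nat list \<Rightarrow> 'a::field" where
  "hj [] = 0"
| "hj [c] = of_nat c"
| "hj (c # d # cs) = of_nat c - 1 / hj (d # cs)"

definition infinite_expansion :: "real \<Rightarrow> nat stream \<Rightarrow> bool" where
  "infinite_expansion x c \<longleftrightarrow>
     (\<forall>a \<in> sset c. 2 \<le> a) \<and> (\<lambda>N. hj (stake (Suc N) c)) \<longlonglongrightarrow> x"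

definition finite_expansion :: "rat \<Rightarrow> nat list \<Rightarrow> bool" where
  "finite_expansion r cs \<longleftrightarrow> cs \<noteq> [] \<and> (\<forall>a \<in> set cs. 2 \<le> a) \<and> hj cs = r"

text \<open>\<open>Terminating cs\<close> is the code consisting of \<open>cs\<close> followed by $\infty$. That all
  digits are at least 2 is not part of the type; it is enforced by \<open>has_code\<close>.\<close>

datatype code = Terminating "nat list" | Infinite "nat stream"

inductive has_code :: "cantor_line \<Rightarrow> code \<Rightarrow> bool" where
  "has_code PosInf (Terminating [])"
| "has_code (RatPlus 1) (Infinite (sconst 2))"
| "1 < r \<Longrightarrow> finite_expansion r cs \<Longrightarrow> has_code (RatMinus r) (Terminating cs)"
| "1 < r \<Longrightarrow> finite_expansion r (cs @ [c]) \<Longrightarrow>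
     has_code (RatPlus r) (Infinite ((cs @ [c + 1]) @- sconst 2))"
| "1 < real_of_irrational x \<Longrightarrow> infinite_expansion (real_of_irrational x) c \<Longrightarrow>
     has_code (Irr x) (Infinite c)"


section \<open>The $q$-deformations and their reduction modulo 2\<close>

definition q_int :: "nat \<Rightarrow> 'a::idom_divide poly" where
  "q_int n = (1 - monom 1 n) div (1 - monom 1 1)"

lemma q_int_eq_sum: "q_int n = (\<Sum>i<n. monom (1::'a::idom_divide) i)"
proof -
  have "1 - monom 1 n = (1 - monom 1 1) * (\<Sum>i<n. monom (1::'a) i)"
    using one_diff_power_eq[of "monom (1::'a) 1" n] by (simp add: monom_power)
  moreover have "coeff (1 - monom (1::'a) 1) 0 \<noteq> 0"
    by simp
  then have "1 - monom (1::'a) 1 \<noteq> 0"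
    by (metis coeff_0)
  ultimately show ?thesis by (simp add: q_int_def)
qed

text \<open>\<open>q_cf e [c\<^sub>1, \<dots>, c\<^sub>N]\<close> is
  $[c_1]_q - q^{c_1-1}/([c_2]_q - \cdots q^{c_{N-1}-1}/e(c_N))$. For digits at least 2 and the
  two choices of $e$ below, all denominators have constant term 1, so that
  \<open>fps_right_inverse _ 1\<close> is their inverse in $\mathbb Z[[q]]$ (the type class operation
  \<open>inverse\<close> does not exist there, since it needs one on the coefficients).\<close>

fun q_cf :: "(nat \<Rightarrow> int fps) \<Rightarrow> nat list \<Rightarrow> int fps" where
  "q_cf e [] = 0"
| "q_cf e [c] = e c"
| "q_cf e (c # d # cs) =
     fps_of_poly (q_int c) - fps_X ^ (c - 1) * fps_right_inverse (q_cf e (d # cs)) 1"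

definition q_last :: "nat \<Rightarrow> int fps" where
  "q_last c = fps_of_poly (q_int c)"

definition q_last_minus :: "nat \<Rightarrow> int fps" where
  "q_last_minus c = fps_of_poly (q_int c) - fps_X ^ (c - 1) * (1 - fps_X)"

text \<open>The limit is taken in the metric of formal power series, which is the $q$-adic one.\<close>

definition q_real_ge1 :: "real \<Rightarrow> int fps" where
  "q_real_ge1 x =
     (let c = (THE c. infinite_expansion x c) in lim (\<lambda>N. q_cf q_last (stake (Suc N) c)))"

definition q_rat_minus_gt1 :: "rat \<Rightarrow> int fps" where
  "q_rat_minus_gt1 r = q_cf q_last_minus (THE cs. finite_expansion r cs)"

text \<open>The rule $[x+1]_q = q[x]_q + 1$ solved for $[x]_q$. Below it is iterated from the least
  $n \ge 0$ for which $x + n$ lies in the range of the previous definitions. Outside the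
  nonnegative part of the line this produces negative powers of $q$.\<close>

definition q_down :: "int fls \<Rightarrow> int fls" where
  "q_down f = fls_X_inv * (f - 1)"

definition q_real :: "real \<Rightarrow> int fls" where
  "q_real x =
     (let n = nat (1 - \<lfloor>x\<rfloor>) in (q_down ^^ n) (fps_to_fls (q_real_ge1 (x + of_nat n))))"

definition q_rat_minus :: "rat \<Rightarrow> int fls" where
  "q_rat_minus r =
     (let n = nat (2 - \<lceil>r\<rceil>) in (q_down ^^ n) (fps_to_fls (q_rat_minus_gt1 (r + of_nat n))))"

definition fls_mod2 :: "int fls \<Rightarrow> bit fls" where
  "fls_mod2 f = Abs_fls (\<lambda>k. of_int (fls_nth f k))"

definition H2 :: "bit fls" where
  "H2 = 1 / (1 - fls_X)"

text \<open>Values lie in $\mathbb F_2((q)) \sqcup \{\infty\}$, with \<open>None\<close> for $\infty$.\<close>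

fun Phi2 :: "cantor_line \<Rightarrow> bit fls option" where
  "Phi2 NegInf = None"
| "Phi2 PosInf = Some H2"
| "Phi2 (RatMinus r) = Some (fls_mod2 (q_rat_minus r))"
| "Phi2 (RatPlus r) = Some (fls_mod2 (q_real (of_rat r)))"
| "Phi2 (Irr x) = Some (fls_mod2 (q_real (real_of_irrational x)))"

definition poly_to_fls :: "bit poly \<Rightarrow> bit fls" where
  "poly_to_fls p = fps_to_fls (fps_of_poly p)"

definition F2q :: "bit fls set" where
  "F2q = range poly_to_fls"

definition H2_plus_F2q :: "bit fls set" where
  "H2_plus_F2q = {H2 + f | f. f \<in> F2q}"


section \<open>Matrices and the fixed-point polynomial of a period\<close>

definition Mmat :: "nat \<Rightarrow> (bit poly)^2^2" where
  "Mmat a = vector [vector [q_int a, monom 1 (a - 1)], vector [1, 0]]"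

definition Mprod :: "nat list \<Rightarrow> (bit poly)^2^2" where
  "Mprod as = foldr (\<lambda>a A. Mmat a ** A) as (mat 1)"

text \<open>$CY^2 + (A+D)Y + B$ as a polynomial in $Y$ over $\mathbb F_2[q]$.\<close>

definition period_poly :: "nat list \<Rightarrow> bit poly poly" where
  "period_poly cs =
     (let M = Mprod cs in [: M $ 1 $ 2, M $ 1 $ 1 + M $ 2 $ 2, M $ 2 $ 1 :])"

definition to_F2_q :: "bit poly \<Rightarrow> bit poly fract" where
  "to_F2_q p = Fract p 1"

definition splits :: "'a::field poly \<Rightarrow> bool" where
  "splits p \<longleftrightarrow> (\<exists>ys. p = smult (lead_coeff p) (\<Prod>y\<leftarrow>ys. [:- y, 1:]))"

definition period_splits :: "nat list \<Rightarrow> bool" where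
  "period_splits cs \<longleftrightarrow> splits (map_poly to_F2_q (period_poly cs))"

text \<open>\<open>Y\<close> is a root in $1 + q\,\mathbb F_2[[q]]$.\<close>

definition unit_root :: "nat list \<Rightarrow> bit fps \<Rightarrow> bool" where
  "unit_root cs Y \<longleftrightarrow>
     fps_nth Y 0 = 1 \<and> poly (map_poly fps_of_poly (period_poly cs)) Y = 0"

definition root_lowest_terms :: "nat list \<Rightarrow> bit poly \<Rightarrow> bit poly \<Rightarrow> bool" where
  "root_lowest_terms cs P Q \<longleftrightarrow>
     coprime P Q \<and> Q \<noteq> 0 \<and>
     (\<exists>Y. unit_root cs Y \<and> fps_to_fls Y = poly_to_fls P / poly_to_fls Q)"

definition Num :: "nat list \<Rightarrow> bit poly \<Rightarrow> bit poly \<Rightarrow> bit poly" where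
  "Num bs P Q = Mprod bs $ 1 $ 1 * P + Mprod bs $ 1 $ 2 * Q"

definition Delta :: "nat list \<Rightarrow> bit poly \<Rightarrow> bit poly \<Rightarrow> bit poly" where
  "Delta bs P Q = Mprod bs $ 2 $ 1 * P + Mprod bs $ 2 $ 2 * Q"

text \<open>\<open>test_data x bs P Q\<close>: the tests are applicable to \<open>x\<close>, with preperiod (or terminating
  code) \<open>bs\<close> and with \<open>P / Q\<close> as the value of the tail.\<close>

definition test_data :: "cantor_line \<Rightarrow> nat list \<Rightarrow> bit poly \<Rightarrow> bit poly \<Rightarrow> bool" where
  "test_data x bs P Q \<longleftrightarrow>
     has_code x (Terminating bs) \<and> P = 1 \<and> Q = 1 + monom 1 1 \<or>
     (\<exists>cs. cs \<noteq> [] \<and> has_code x (Infinite (bs @- cycle cs)) \<and> period_splits cs \<and>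
           root_lowest_terms cs P Q)"

definition criterion_a :: "cantor_line \<Rightarrow> bool" where
  "criterion_a x \<longleftrightarrow> (\<exists>bs P Q. test_data x bs P Q \<and> Delta bs P Q dvd Num bs P Q)"

definition criterion_b :: "cantor_line \<Rightarrow> bool" where
  "criterion_b x \<longleftrightarrow> (\<exists>bs P Q. test_data x bs P Q \<and>
       (1 - monom 1 1) * Delta bs P Q dvd Delta bs P Q + (1 - monom 1 1) * Num bs P Q)"

end

theory Submission imports Defs begin

text \<open>Modulo 2 all signs disappear, and the value of an infinite code is the unique function with
  $F(c_1,c_2,\ldots) = [c_1]_q + q^{c_1-1}/F(c_2,c_3,\ldots)$ and values in $1+q\,\mathbb F_2[[q]]$.
  One step is the action of $M_{c_1}$ by a linear fractional transformation
  (\<open>Mprod_action\<close>). Hence a finite prefix acts through the product of its matrices, a purely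
  periodic code has as its value a fixed point of the matrix of the period, and this fixed point is
  the only root of $CY^2+(A+D)Y+B$ in $1+q\,\mathbb F_2[[q]]$, because modulo $q$ this polynomial is
  $Y^2+Y$ (\<open>unit_root_unique\<close>). It splits over $\mathbb F_2(q)$ exactly when that power series is
  rational, and by the substitution $Y = (A+D)u/C$ exactly when $u^2+u = BC/(A+D)^2$ is solvable. A
  terminating code is a prefix followed by a tail with value $H_2=1/(1+q)$. Given
  $\Phi_2(x)=N/\Delta$, the two criteria are mere divisibility statements.

  That the tests are exhaustive rests on two facts. The digit $c_1$, hence by iteration the whole
  code, is determined by $F$ (\<open>code_value_inj\<close>). And if $F(c_1,c_2,\ldots) = P/Q$, then the tail has
  the value $Q/((P+[c_1]_qQ)/q^{c_1-1})$, where numerator and denominator have degrees no larger than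
  the maximum of the degrees of $P$ and $Q$ (\<open>rational_tail\<close>). Over $\mathbb F_2$ only finitely
  many pairs of polynomials obey this bound, so two tails of the code coincide and the code is
  eventually periodic (\<open>rational_fps_eventually_periodic\<close>).

  It remains to connect this with the points of the line. The code of a point exists and is unique,
  which is the theory of negative continued fractions of real and rational numbers, and the
  $q$-adic limits over the integers exist because each step is a contraction. The statements on
  coefficients follow since a power series over $\mathbb F_2$ is a polynomial, or $H_2$ plus a
  polynomial, exactly when its coefficients are eventually 0, or eventually 1. These conditions do
  not change under $g \mapsto qg+1$, which reduces points below 1 to points above it.\<close>

(* Only power series are indexed with the dollar sign until the final theorem. *)
unbundle no vec_syntax

section \<open>Negative continued fractions of real and rational numbers\<close>

lemma hj_Cons: "cs \<noteq> [] \<Longrightarrow> hj (c # cs) = of_nat c - 1 / hj cs"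
  by (cases cs) auto

lemma hj_bounds:
  assumes "cs \<noteq> []" "\<forall>a\<in>set cs. 2 \<le> a"
  shows "1 < (hj cs :: 'a :: linordered_field)"
    and "of_nat (hd cs) - 1 < (hj cs :: 'a)"
    and "(hj cs :: 'a) \<le> of_nat (hd cs)"
proof -
  have "1 < (hj cs :: 'a) \<and> of_nat (hd cs) - 1 < (hj cs :: 'a) \<and> (hj cs :: 'a) \<le> of_nat (hd cs)"
    using assms
  proof (induction cs rule: induct_list012)
    case (2 c)
    have "(2::'a) \<le> of_nat c" using 2 by (metis of_nat_le_iff of_nat_numeral list.set_intros(1))
    then show ?case by auto
  next
    case (3 c d cs)
    then have IH: "1 < (hj (d # cs) :: 'a)" by auto
    define v where "v = (hj (d # cs) :: 'a)"
    have "(2::'a) \<le> of_nat c" using 3 by (metis of_nat_le_iff of_nat_numeral list.set_intros(1))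
    moreover have "0 < 1 / v" "1 / v < 1" using IH by (auto simp: v_def)
    ultimately have "1 < of_nat c - 1 / v \<and> of_nat c - 1 < of_nat c - 1 / v \<and> of_nat c - 1 / v \<le> of_nat c"
      by linarith
    then show ?case by (simp add: v_def)
  qed auto
  then show "1 < (hj cs :: 'a)" "of_nat (hd cs) - 1 < (hj cs :: 'a)"
    "(hj cs :: 'a) \<le> of_nat (hd cs)" by auto
qed

lemma of_rat_hj: "of_rat (hj cs) = (hj cs :: 'a :: field_char_0)"
  by (induction cs rule: induct_list012) (auto simp: of_rat_diff of_rat_divide)

text \<open>A digit of an infinite expansion is read off its value as $\lfloor x \rfloor + 1$, because the
  tail $y = 1/(c_1 - x)$ is at least 1. The tail converges because its
  approximants are bounded by their first digit, which keeps $x$ away from $c_1$.\<close>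

lemma infinite_expansion_unfold:
  assumes "infinite_expansion x c"
  shows "of_nat (shd c) - 1 \<le> x" "x < of_nat (shd c)"
    "infinite_expansion (1 / (of_nat (shd c) - x)) (stl c)"
proof -
  define a where "a = (\<lambda>N. hj (stake (Suc N) (stl c)) :: real)"
  define b where "b = (\<lambda>N. hj (stake (Suc N) c) :: real)"
  have dig: "\<forall>a\<in>sset c. 2 \<le> a" and lim: "b \<longlonglongrightarrow> x"
    using assms by (auto simp: infinite_expansion_def b_def)
  have dig': "\<forall>a\<in>sset (stl c). 2 \<le> a" using dig by (metis stl_sset)
  have st: "\<forall>a\<in>set (stake n s). 2 \<le> a" if "\<forall>a\<in>sset s. 2 \<le> a" for n s
    using that by (metis Un_iff sset_shift stake_sdrop)
  show "of_nat (shd c) - 1 \<le> x"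
  proof (rule LIMSEQ_le_const[OF lim])
    show "\<exists>N. \<forall>n\<ge>N. of_nat (shd c) - 1 \<le> b n"
      using hj_bounds(2)[where ?'a = real, OF _ st[OF dig]] unfolding b_def
      by (metis less_imp_le stake_invert_Nil nat.simps(3) stake.simps(2) list.sel(1))
  qed
  have ab: "b (Suc n) = of_nat (shd c) - 1 / a n" for n
    by (simp add: a_def b_def)
  have a1: "1 < a n" "a n \<le> of_nat (shd (stl c))" for n
    using hj_bounds(1,3)[where ?'a = real, OF _ st[OF dig', of "Suc n"]] by (auto simp: a_def)
  have lim': "(\<lambda>n. b (Suc n)) \<longlonglongrightarrow> x" using lim by (rule LIMSEQ_Suc)
  have "x \<le> of_nat (shd c) - 1 / of_nat (shd (stl c))"
  proof (rule LIMSEQ_le_const2[OF lim'])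
    show "\<exists>N. \<forall>n\<ge>N. b (Suc n) \<le> of_nat (shd c) - 1 / of_nat (shd (stl c))"
    proof (intro exI allI impI)
      fix n
      have "1 / of_nat (shd (stl c)) \<le> 1 / a n" using a1[of n] by (intro divide_left_mono) auto
      then show "b (Suc n) \<le> of_nat (shd c) - 1 / of_nat (shd (stl c))" by (simp add: ab)
    qed
  qed
  moreover have "0 < real (shd (stl c))" using a1[of 0] by linarith
  then have "0 < 1 / real (shd (stl c))" by simp
  ultimately show lt: "x < of_nat (shd c)" by linarith
  have "a n = 1 / (of_nat (shd c) - b (Suc n))" for n
    using a1(1)[of n] by (simp add: ab)
  then have "a = (\<lambda>n. 1 / (of_nat (shd c) - b (Suc n)))" by auto
  moreover have "(\<lambda>n. 1 / (of_nat (shd c) - b (Suc n))) \<longlonglongrightarrow> 1 / (of_nat (shd c) - x)"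
    using lt by (intro tendsto_intros lim') auto
  ultimately show "infinite_expansion (1 / (of_nat (shd c) - x)) (stl c)"
    using dig' by (simp add: infinite_expansion_def a_def)
qed

lemma infinite_expansion_unique:
  assumes "infinite_expansion x c" "infinite_expansion x d"
  shows "c = d"
  using assms
proof (coinduction arbitrary: x c d)
  case Eq_stream
  have eq: "shd c = shd d"
    using infinite_expansion_unfold(1,2)[OF Eq_stream(1)]
      infinite_expansion_unfold(1,2)[OF Eq_stream(2)] by linarith
  have "infinite_expansion (1 / (of_nat (shd c) - x)) (stl d)"
    using infinite_expansion_unfold(3)[OF Eq_stream(2)] unfolding eq .
  with eq infinite_expansion_unfold(3)[OF Eq_stream(1)] show ?case by blast
qed

lemma infinite_expansion_Cons:
  assumes "infinite_expansion y c" "y \<noteq> 0" "2 \<le> d"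
  shows "infinite_expansion (of_nat d - 1 / y) (d ## c)"
proof -
  have "(\<lambda>N. of_nat d - 1 / hj (stake (Suc N) c)) \<longlonglongrightarrow> of_nat d - 1 / y"
    using assms by (intro tendsto_intros) (auto simp: infinite_expansion_def)
  then have "(\<lambda>N. hj (stake (Suc N) (d ## c))) \<longlonglongrightarrow> of_nat d - 1 / y"
    by (subst filterlim_sequentially_Suc[symmetric]) simp
  then show ?thesis using assms by (auto simp: infinite_expansion_def)
qed

text \<open>Replacing the tail \<open>y\<close> of a negative continued fraction: since $v \mapsto c - 1/v$ turns a
  distance $e$ of two points $\ge 1$ into one of at most $e/(1+e)$, the reciprocal distance grows by
  at least one per digit. No uniform contraction holds, as the point $1 = [[2,2,\ldots]]$ shows.\<close>

lemma abs_hj_diff_le: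
  fixes y :: real
  assumes "cs \<noteq> []" "\<forall>a\<in>set cs. 2 \<le> a" "1 \<le> y"
  defines "X \<equiv> \<lambda>cs. foldr (\<lambda>c v. of_nat c - 1 / v) cs y"
  shows "1 \<le> X cs \<and> \<bar>hj cs - X cs\<bar> \<le> 1 / length cs"
  using assms(1,2)
proof (induction cs rule: list_nonempty_induct)
  case (single c)
  have "1 / y \<le> 1" "0 \<le> 1 / y" using assms(3) by auto
  moreover have "real c \<ge> 2" using single by auto
  ultimately show ?case by (auto simp: X_def)
next
  case (cons c cs)
  define u v where "u = X cs" and "v = (hj cs :: real)"
  define n where "n = real (length cs)"
  have n: "n \<ge> 1" using cons(1) by (cases cs) (auto simp: n_def)
  have u: "1 \<le> u" and uv: "\<bar>v - u\<bar> \<le> 1 / n" using cons by (auto simp: u_def v_def n_def)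
  have v: "1 < v" using hj_bounds(1)[OF cons(1)] cons.prems by (auto simp: v_def)
  have "1 / u \<le> 1" using u by auto
  moreover have "real c \<ge> 2" using cons by auto
  ultimately have "1 \<le> X (c # cs)" by (auto simp: X_def u_def)
  moreover have "hj (c # cs) - X (c # cs) = 1 / u - 1 / v"
    using cons(1) by (simp add: X_def u_def v_def hj_Cons)
  moreover have main: "1 / s - 1 / t \<le> 1 / (n + 1)" if "1 \<le> s" "s \<le> t" "t - s \<le> 1 / n" for s t
  proof -
    have "(t - s) * n \<le> 1" using that n by (simp add: pos_le_divide_eq)
    \<comment> \<open>With $1 \le s \le t$ the product dominates the distance by one; this is $0 \le (s-1)(t+1)$.\<close>
    moreover have "t - s \<le> s * t - 1"
    proof -
      have "0 \<le> (s - 1) * (t + 1)" using that by auto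
      then show ?thesis by (simp add: algebra_simps)
    qed
    ultimately have "(t - s) * (n + 1) \<le> s * t" by (simp add: algebra_simps)
    then show ?thesis using that n by (simp add: field_simps)
  qed
  have "\<bar>1 / u - 1 / v\<bar> \<le> 1 / (n + 1)"
  proof (cases "u \<le> v")
    case True
    then have "1 / v \<le> 1 / u" using u by (simp add: frac_le)
    then show ?thesis using main[of u v] True u uv by auto
  next
    case False
    then have "1 / u \<le> 1 / v" using v by (simp add: frac_le)
    then show ?thesis using main[of v u] False v uv by auto
  qed
  ultimately show ?case by (simp add: n_def add.commute)
qed

text \<open>The digits are generated by iterating $y \mapsto 1/(\lfloor y \rfloor + 1 - y)$, which preserves
  $y \ge 1$; the previous estimate bounds the error of the approximants by the reciprocal length.\<close>

lemma infinite_expansion_exists: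
  assumes "1 \<le> x"
  shows "\<exists>c. infinite_expansion x c"
proof -
  define dig where "dig = (\<lambda>y::real. nat (\<lfloor>y\<rfloor> + 1))"
  define nxt where "nxt = (\<lambda>y::real. 1 / (of_nat (dig y) - y))"
  have nxt1: "1 \<le> nxt y" if "1 \<le> y" for y
  proof -
    have "real (dig y) = of_int \<lfloor>y\<rfloor> + 1" using that by (simp add: dig_def)
    then have "0 < real (dig y) - y" "real (dig y) - y \<le> 1" by linarith+
    then show ?thesis by (simp add: nxt_def)
  qed
  have dig2: "2 \<le> dig y" if "1 \<le> y" for y
    using that by (simp add: dig_def le_nat_iff)
  define c where "c = (\<lambda>y. smap dig (siterate nxt y))"
  have c_unfold: "c y = dig y ## c (nxt y)" for y unfolding c_def by (subst siterate.code) simp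
  have step: "y = of_nat (dig y) - 1 / nxt y" for y by (simp add: nxt_def)
  have ge1: "1 \<le> (nxt ^^ n) y" if "1 \<le> y" for n y using that by (induction n) (auto intro: nxt1)
  have digits: "\<forall>a\<in>sset (c y). 2 \<le> a" if "1 \<le> y" for y
    using ge1[OF that] dig2 by (auto simp: c_def stream.set_map sset_siterate)
  have fold: "y = foldr (\<lambda>c v. of_nat c - 1 / v) (stake n (c y)) ((nxt ^^ n) y)" for n y
  proof (induction n arbitrary: y)
    case (Suc n)
    show ?case using Suc[of "nxt y"] step[of y]
      by (subst c_unfold) (simp add: funpow_swap1)
  qed auto
  have "\<bar>hj (stake (Suc n) (c x)) - x\<bar> \<le> 1 / Suc n" for n
  proof -
    have "\<forall>a\<in>set (stake (Suc n) (c x)). 2 \<le> a"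
      using digits[OF assms] by (metis Un_iff sset_shift stake_sdrop)
    then show ?thesis
      using abs_hj_diff_le[of "stake (Suc n) (c x)" "(nxt ^^ Suc n) x"] ge1[OF assms, of "Suc n"]
        fold[of x "Suc n"] by (metis length_stake stake_invert_Nil nat.simps(3))
  qed
  then have "(\<lambda>n. hj (stake (Suc n) (c x)) - x) \<longlonglongrightarrow> 0"
    by (intro Lim_null_comparison[OF _ LIMSEQ_inverse_real_of_nat])
       (auto simp: inverse_eq_divide)
  then have "(\<lambda>n. hj (stake (Suc n) (c x))) \<longlonglongrightarrow> x" using LIM_zero_iff by fast
  then show ?thesis using digits[OF assms] by (auto simp: infinite_expansion_def)
qed

lemma infinite_expansion_one: "infinite_expansion 1 (sconst 2)"
proof -
  obtain c where c: "infinite_expansion 1 c" using infinite_expansion_exists[of 1] by auto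
  have "c = sconst 2" using c
  proof (coinduction arbitrary: c)
    case Eq_stream
    then have s: "shd c = 2" using infinite_expansion_unfold(1,2)[of 1 c] by linarith
    then show ?case using infinite_expansion_unfold(3)[OF Eq_stream] by simp
  qed
  then show ?thesis using c by simp
qed

text \<open>The doubled rational $r_+$: in $[[c_1,\ldots,c_N]]$ the last digit may be replaced by
  $c_N + 1 - 1/1$ with $1 = [[2,2,\ldots]]$.\<close>

lemma infinite_expansion_hj:
  assumes "\<forall>a\<in>set (cs @ [c]). 2 \<le> a"
  shows "infinite_expansion (hj (cs @ [c])) ((cs @ [c + 1]) @- sconst 2)"
  using assms
proof (induction cs)
  case Nil
  have "infinite_expansion (real (c + 1) - 1 / 1) ((c + 1) ## sconst 2)"
    using Nil by (intro infinite_expansion_Cons[OF infinite_expansion_one]) auto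
  moreover have "real (c + 1) - 1 / 1 = hj ([] @ [c])" by simp
  ultimately show ?case by (simp only: append_Nil shift.simps)
next
  case (Cons d cs)
  have "hj (cs @ [c]) \<noteq> (0::real)" using hj_bounds(1)[of "cs @ [c]", where ?'a = real] Cons by auto
  then show ?case using infinite_expansion_Cons[of "hj (cs @ [c])" _ d] Cons
    by (auto simp: hj_Cons)
qed

text \<open>The Euclidean algorithm with remainders taken from above: for $a/b$ the first digit is
  $\lceil a/b \rceil = c$ and the tail $b/(cb - a)$ has a smaller denominator.\<close>

lemma finite_expansion_exists:
  assumes "1 < r"
  shows "\<exists>cs. finite_expansion r cs"
proof -
  have "\<exists>cs. cs \<noteq> [] \<and> (\<forall>c\<in>set cs. 2 \<le> c) \<and> hj cs = (of_nat a / of_nat b :: rat)"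
    if "0 < b" "b < a" for a b :: nat
    using that
  proof (induction b arbitrary: a rule: less_induct)
    case (less b)
    show ?case
    proof (cases "b dvd a")
      case True
      then obtain k where k: "a = b * k" by auto
      then have "2 \<le> k" using less.prems by (cases "k = 0 \<or> k = 1") auto
      then show ?thesis using less.prems k by (intro exI[of _ "[k]"]) auto
    next
      case False
      define c where "c = a div b + 1"
      define d where "d = c * b - a"
      have mod: "0 < a mod b" "a mod b < b" using False less.prems by (auto simp: mod_greater_zero_iff_not_dvd)
      have "a = a div b * b + a mod b" "c * b = a div b * b + b" by (simp_all add: c_def)
      then have d: "d = b - a mod b" "c * b = a + d" using mod unfolding d_def by linarith+
      then have d': "0 < d" "d < b" using mod by auto
      have c2: "2 \<le> c" using less.prems by (auto simp: c_def Suc_le_eq div_greater_zero_iff)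
      obtain cs where cs: "cs \<noteq> []" "\<forall>c\<in>set cs. 2 \<le> c" "hj cs = (of_nat b / of_nat d :: rat)"
        using less.IH[of d b] d' by auto
      have "of_nat c * of_nat b = (of_nat a + of_nat d :: rat)"
        using d(2) by (metis of_nat_add of_nat_mult)
      then have "(of_nat a / of_nat b :: rat) = of_nat c - 1 / (of_nat b / of_nat d)"
        using less.prems by (simp add: field_simps)
      then show ?thesis using cs c2 by (intro exI[of _ "c # cs"]) (auto simp: hj_Cons)
    qed
  qed
  note main = this
  obtain a b where "quotient_of r = (a, b)" by (cases "quotient_of r")
  then have b: "b > 0" and r: "r = of_int a / of_int b"
    by (auto simp: quotient_of_denom_pos quotient_of_div)
  then have "b < a" using assms by simp
  then show ?thesis
    using main[of "nat b" "nat a"] b by (auto simp: finite_expansion_def r)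
qed

lemma finite_expansion_unique:
  assumes "finite_expansion r cs" "finite_expansion r ds"
  shows "cs = ds"
  using assms
proof (induction cs arbitrary: r ds)
  case (Cons c cs)
  obtain d ds' where ds: "ds = d # ds'" using Cons by (cases ds) (auto simp: finite_expansion_def)
  have bd: "of_nat (hd es) - 1 < r \<and> r \<le> of_nat (hd es)" if "finite_expansion r es" for es
    using hj_bounds(2,3)[of es, where ?'a = rat] that by (auto simp: finite_expansion_def)
  have "of_nat c - 1 < (of_nat d :: rat)" "of_nat d - 1 < (of_nat c :: rat)"
    using bd[OF Cons(2)] bd[OF Cons(3)] ds by auto
  then have "c < d + 1" "d < c + 1"
    by linarith+
  then have cd: "c = d" by simp
  have tl: "es = [] \<and> r = of_nat c \<or> es \<noteq> [] \<and> r \<noteq> of_nat c \<and> finite_expansion (1 / (of_nat c - r)) es"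
    if "finite_expansion r (c # es)" for es
  proof (cases "es = []")
    case False
    then have "1 < (hj es :: rat)" using hj_bounds(1)[of es] that by (auto simp: finite_expansion_def)
    moreover have "r = of_nat c - 1 / hj es" using False that by (auto simp: finite_expansion_def hj_Cons)
    ultimately show ?thesis using False that by (auto simp: finite_expansion_def)
  qed (use that in \<open>auto simp: finite_expansion_def\<close>)
  show ?case using tl[OF Cons(2)] tl[of ds'] Cons(1,3) ds cd by auto
qed (auto simp: finite_expansion_def)

section \<open>Continued fractions of power series\<close>

lemma coeff_q_int: "coeff (q_int c) n = (if n < c then 1 else (0 :: 'a :: idom_divide))"
  by (simp add: q_int_eq_sum coeff_sum)

text \<open>Closeness in the $q$-adic metric. Written as divisibility it passes through ring identities;
  read coefficientwise (\<open>fps_cong_iff\<close>) it yields limits.\<close>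

definition fps_cong :: "nat \<Rightarrow> 'a::comm_ring_1 fps \<Rightarrow> 'a fps \<Rightarrow> bool" where
  "fps_cong k f g \<longleftrightarrow> fps_X ^ k dvd f - g"

lemma fps_X_power_dvd_iff:
  fixes f :: "'a::comm_ring_1 fps"
  shows "fps_X ^ k dvd f \<longleftrightarrow> (\<forall>i<k. f $ i = 0)"
proof
  assume "\<forall>i<k. f $ i = 0"
  then have "f = fps_X ^ k * fps_shift k f"
    by (intro fps_ext) (simp add: fps_X_power_mult_nth)
  then show "fps_X ^ k dvd f" by (rule dvdI)
qed (auto elim!: dvdE simp: fps_X_power_mult_nth)

lemma fps_cong_iff: "fps_cong k f g \<longleftrightarrow> (\<forall>i<k. f $ i = g $ i)"
  by (simp add: fps_cong_def fps_X_power_dvd_iff)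

definition q_cf_step :: "nat \<Rightarrow> int fps \<Rightarrow> int fps" where
  "q_cf_step c y = fps_of_poly (q_int c) - fps_X ^ (c - 1) * fps_right_inverse y 1"

lemma q_cf_Cons: "cs \<noteq> [] \<Longrightarrow> q_cf e (c # cs) = q_cf_step c (q_cf e cs)"
  by (cases cs) (auto simp: q_cf_step_def)

lemma q_cf_step_nth_0: "2 \<le> c \<Longrightarrow> q_cf_step c y $ 0 = 1"
  by (simp add: q_cf_step_def coeff_q_int fps_X_power_mult_nth)

lemma q_cf_nth_0:
  fixes e :: "nat \<Rightarrow> int fps"
  assumes "cs \<noteq> []" "\<forall>a\<in>set cs. 2 \<le> a" "\<And>c. 2 \<le> c \<Longrightarrow> e c $ 0 = 1"
  shows "q_cf e cs $ 0 = 1"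
  using assms by (cases "(e, cs)" rule: q_cf.cases)
    (auto simp: q_cf_step_nth_0 q_cf_Cons simp del: q_cf.simps(3))

text \<open>Each step is a $q$-adic contraction, because the power $q^{c-1}$ in front of the tail has
  positive exponent and units differ from each other as much as their inverses do.\<close>

lemma q_cf_step_cong:
  assumes "fps_cong k y z" "2 \<le> c" "y $ 0 = 1" "z $ 0 = 1"
  shows "fps_cong (Suc k) (q_cf_step c y) (q_cf_step c z)"
proof -
  define i j where "i = fps_right_inverse y 1" and "j = fps_right_inverse z 1"
  have inv: "y * i = 1" "z * j = 1"
    using assms by (auto simp: i_def j_def intro!: fps_right_inverse)
  have "q_cf_step c y - q_cf_step c z = fps_X ^ (c - 1) * (j * 1 - i * 1)"
    by (simp add: q_cf_step_def i_def j_def algebra_simps)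
  also have "\<dots> = fps_X ^ (c - 1) * (j * (y * i) - i * (z * j))"
    by (simp only: inv)
  also have "\<dots> = fps_X ^ (c - 1) * ((y - z) * (i * j))" by (simp add: algebra_simps)
  finally have eq: "q_cf_step c y - q_cf_step c z = fps_X ^ (c - 1) * ((y - z) * (i * j))" .
  have "fps_X ^ 1 * fps_X ^ k dvd fps_X ^ (c - 1) * ((y - z) * (i * j))"
    using assms unfolding fps_cong_def
    by (intro mult_dvd_mono le_imp_power_dvd dvd_mult2) auto
  then show ?thesis by (simp add: fps_cong_def eq)
qed

text \<open>The $q$-adic limit, written with the diagonal of the table of coefficients of the approximants:
  the coefficient at $q^j$ is final from the approximant of length $j + 1$ on.\<close>

definition q_cf_limit :: "nat stream \<Rightarrow> int fps" where
  "q_cf_limit c = Abs_fps (\<lambda>j. q_cf q_last (stake (Suc j) c) $ j)"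

lemma q_last_nth_0: "2 \<le> c \<Longrightarrow> q_last c $ 0 = 1"
  by (simp add: q_last_def coeff_q_int)

lemma digits_stake: "\<forall>a\<in>sset c. 2 \<le> a \<Longrightarrow> \<forall>a\<in>set (stake n c). 2 \<le> a"
  by (metis Un_iff sset_shift stake_sdrop)

lemma digits_sdrop: "\<forall>a\<in>sset c. 2 \<le> a \<Longrightarrow> \<forall>a\<in>sset (sdrop n c). 2 \<le> a"
  by (metis Un_iff sset_shift stake_sdrop)

lemma digits_stl: "\<forall>a\<in>sset c. 2 \<le> a \<Longrightarrow> \<forall>a\<in>sset (stl c). 2 \<le> a"
  using digits_sdrop[of c 1] by simp

lemma q_cf_stake_nth_0:
  "\<forall>a\<in>sset c. 2 \<le> a \<Longrightarrow> q_cf q_last (stake (Suc n) c) $ 0 = 1"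
  using digits_stake[of c "Suc n"] by (intro q_cf_nth_0 q_last_nth_0) auto

lemma q_cf_stake_cong:
  assumes "\<forall>a\<in>sset c. 2 \<le> a"
  shows "fps_cong (Suc n) (q_cf q_last (stake (Suc (n + m)) c)) (q_cf q_last (stake (Suc n) c))"
  using assms
proof (induction n arbitrary: c)
  case 0
  then show ?case using q_cf_stake_nth_0 by (auto simp: fps_cong_iff simp del: stake.simps)
next
  case (Suc n)
  have dig: "\<forall>a\<in>sset (stl c). 2 \<le> a" "2 \<le> shd c"
    using Suc.prems digits_stl by (auto simp: shd_sset)
  then have "fps_cong (Suc (Suc n))
     (q_cf_step (shd c) (q_cf q_last (stake (Suc (n + m)) (stl c))))
     (q_cf_step (shd c) (q_cf q_last (stake (Suc n) (stl c))))"
    using Suc.IH by (intro q_cf_step_cong q_cf_stake_nth_0) auto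
  then show ?case by (simp only: stake.simps(2)[of _ c] add_Suc) (simp add: q_cf_Cons del: q_cf.simps(3))
qed

lemma q_cf_stake_cong_limit:
  assumes "\<forall>a\<in>sset c. 2 \<le> a"
  shows "fps_cong (Suc n) (q_cf q_last (stake (Suc n) c)) (q_cf_limit c)"
proof -
  have "q_cf q_last (stake (Suc n) c) $ i = q_cf q_last (stake (Suc i) c) $ i" if "i < Suc n" for i
    using q_cf_stake_cong[OF assms, of i "n - i"] that by (simp add: fps_cong_iff del: stake.simps)
  then show ?thesis by (simp add: fps_cong_iff q_cf_limit_def del: stake.simps)
qed

lemma q_cf_limit_nth_0: "\<forall>a\<in>sset c. 2 \<le> a \<Longrightarrow> q_cf_limit c $ 0 = 1"
  using q_cf_stake_nth_0[of c 0] by (simp add: q_cf_limit_def)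

lemma q_cf_limit_unfold:
  assumes "\<forall>a\<in>sset c. 2 \<le> a"
  shows "q_cf_limit c = q_cf_step (shd c) (q_cf_limit (stl c))"
proof (rule fps_ext)
  fix n
  have dig: "\<forall>a\<in>sset (stl c). 2 \<le> a" "2 \<le> shd c"
    using assms digits_stl by (auto simp: shd_sset)
  have "fps_cong (Suc (Suc n)) (q_cf_step (shd c) (q_cf q_last (stake (Suc n) (stl c))))
      (q_cf_step (shd c) (q_cf_limit (stl c)))"
    using dig by (intro q_cf_step_cong q_cf_stake_cong_limit q_cf_stake_nth_0 q_cf_limit_nth_0) auto
  moreover have "q_cf_step (shd c) (q_cf q_last (stake (Suc n) (stl c))) = q_cf q_last (stake (Suc (Suc n)) c)"
    by (simp add: q_cf_Cons del: q_cf.simps(3))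
  ultimately show "q_cf_limit c $ n = q_cf_step (shd c) (q_cf_limit (stl c)) $ n"
    using q_cf_stake_cong_limit[OF assms, of "Suc n"] by (simp add: fps_cong_iff)
qed

lemma q_real_ge1_eq:
  assumes "infinite_expansion x c"
  shows "q_real_ge1 x = q_cf_limit c"
proof -
  have the: "(THE c. infinite_expansion x c) = c"
    using assms infinite_expansion_unique by blast
  have "(\<lambda>N. q_cf q_last (stake (Suc N) c)) \<longlonglongrightarrow> q_cf_limit c"
  proof (rule tendsto_fpsI)
    fix n
    show "\<forall>\<^sub>F N in sequentially. q_cf q_last (stake (Suc N) c) $ n = q_cf_limit c $ n"
      using eventually_ge_at_top[of n]
    proof eventually_elim
      case (elim N)
      then show ?case using q_cf_stake_cong_limit[of c N] assms
        by (simp add: fps_cong_iff infinite_expansion_def del: stake.simps)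
    qed
  qed
  then show ?thesis unfolding q_real_ge1_def the Let_def by (rule limI)
qed

section \<open>Reduction modulo 2\<close>

definition fps_mod2 :: "int fps \<Rightarrow> bit fps" where
  "fps_mod2 f = Abs_fps (\<lambda>n. of_int (f $ n))"

lemma fps_mod2_nth [simp]: "fps_mod2 f $ n = of_int (f $ n)"
  by (simp add: fps_mod2_def)

lemma of_int_bit_eq_iff: "(of_int k :: bit) = 0 \<longleftrightarrow> even k" "(of_int k :: bit) = 1 \<longleftrightarrow> odd k"
proof -
  have "(of_int k :: bit) = of_bool (odd k)"
  proof (cases "even k")
    case True
    then obtain m where "k = 2 * m" by auto
    then show ?thesis by simp
  next
    case False
    then obtain m where "k = 2 * m + 1" by (auto elim: oddE)
    then show ?thesis by simp
  qed
  then show "(of_int k :: bit) = 0 \<longleftrightarrow> even k" "(of_int k :: bit) = 1 \<longleftrightarrow> odd k" by auto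
qed

lemma uminus_fps_bit [simp]: "- f = (f :: bit fps)" by (intro fps_ext) simp
lemma minus_fps_bit: "f - g = (f + g :: bit fps)" by (metis diff_conv_add_uminus uminus_fps_bit)
lemma uminus_poly_bit [simp]: "- f = (f :: bit poly)" by (intro poly_eqI) simp
lemma minus_poly_bit: "f - g = (f + g :: bit poly)" by (metis diff_conv_add_uminus uminus_poly_bit)

lemma add_self_fps_bit [simp]: "f + f = (0 :: bit fps)"
  by (metis minus_fps_bit diff_self)
lemma add_self_poly_bit [simp]: "f + f = (0 :: bit poly)"
  by (metis minus_poly_bit diff_self)

lemma fps_mod2_diff: "fps_mod2 (f - g) = fps_mod2 f - fps_mod2 g"
  by (intro fps_ext) (simp del: add_bit_eq_xor minus_bit_def)
lemma fps_mod2_mult: "fps_mod2 (f * g) = fps_mod2 f * fps_mod2 g"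
  by (intro fps_ext) (simp add: fps_mult_nth del: mult_bit_eq_and)
lemma fps_mod2_1 [simp]: "fps_mod2 1 = 1"
  by (intro fps_ext) simp
lemma fps_mod2_X [simp]: "fps_mod2 fps_X = fps_X"
  by (intro fps_ext) (simp add: fps_X_def)
lemma fps_mod2_power: "fps_mod2 (f ^ n) = fps_mod2 f ^ n"
  by (induction n) (auto simp: fps_mod2_mult)
lemma fps_mod2_q_int [simp]: "fps_mod2 (fps_of_poly (q_int c)) = fps_of_poly (q_int c)"
  by (intro fps_ext) (simp add: coeff_q_int)

definition mod2_step :: "nat \<Rightarrow> bit fps \<Rightarrow> bit fps" where
  "mod2_step c y = fps_of_poly (q_int c) + fps_X ^ (c - 1) * inverse y"

lemma fps_mod2_right_inverse:
  assumes "y $ 0 = 1"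
  shows "fps_mod2 (fps_right_inverse y 1) = inverse (fps_mod2 y)"
proof -
  have "y * fps_right_inverse y 1 = 1" using assms by (intro fps_right_inverse) auto
  then have "fps_mod2 y * fps_mod2 (fps_right_inverse y 1) = 1"
    by (metis fps_mod2_1 fps_mod2_mult)
  then show ?thesis by (simp add: fps_inverse_unique)
qed

lemma fps_mod2_q_cf_step:
  "y $ 0 = 1 \<Longrightarrow> fps_mod2 (q_cf_step c y) = mod2_step c (fps_mod2 y)"
  by (simp add: q_cf_step_def mod2_step_def fps_mod2_diff fps_mod2_mult fps_mod2_power
      fps_mod2_right_inverse minus_fps_bit)

lemma mod2_step_nth_0: "2 \<le> c \<Longrightarrow> mod2_step c y $ 0 = 1"
  by (simp add: mod2_step_def coeff_q_int fps_X_power_mult_nth)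

text \<open>$\Phi_2$ on infinite codes. All later arguments go through its constant term 1 and its
  recursion $F(c_1,c_2,\ldots) = [c_1]_q + q^{c_1-1}/F(c_2,c_3,\ldots)$.\<close>

definition code_value :: "nat stream \<Rightarrow> bit fps" where
  "code_value c = fps_mod2 (q_cf_limit c)"

lemma code_value_nth_0: "\<forall>a\<in>sset c. 2 \<le> a \<Longrightarrow> code_value c $ 0 = 1"
  by (simp add: code_value_def q_cf_limit_nth_0)

lemma code_value_unfold:
  assumes "\<forall>a\<in>sset c. 2 \<le> a"
  shows "code_value c = mod2_step (shd c) (code_value (stl c))"
  using q_cf_limit_unfold[OF assms] q_cf_limit_nth_0[OF digits_stl[OF assms]]
  by (simp add: code_value_def fps_mod2_q_cf_step)

lemma code_value_shift:
  assumes "\<forall>a\<in>set bs. 2 \<le> a" "\<forall>a\<in>sset c. 2 \<le> a"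
  shows "code_value (bs @- c) = foldr mod2_step bs (code_value c)"
  using assms(1)
proof (induction bs)
  case (Cons b bs)
  then show ?case using code_value_unfold[of "(b # bs) @- c"] assms by auto
qed simp

text \<open>Modulo 2 a step followed by the tail $H_2 = 1/(1-q)$ gives the modified last entry
  $[c]_q - q^{c-1}(1-q)$ of the left $q$-deformation. So a terminating code behaves like an infinite
  one whose tail has the value $H_2$.\<close>

lemma q_cf_minus_mod2:
  assumes "cs \<noteq> []" "\<forall>a\<in>set cs. 2 \<le> a"
  shows "fps_mod2 (q_cf q_last_minus cs) = foldr mod2_step cs (inverse (1 - fps_X))"
  using assms
proof (induction cs rule: list_nonempty_induct)
  case (single c)
  have "inverse (inverse (1 - fps_X)) = (1 - fps_X :: bit fps)"
    by (rule fps_inverse_idempotent) simp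
  then show ?case
    by (simp add: q_last_minus_def mod2_step_def fps_mod2_diff fps_mod2_mult fps_mod2_power minus_fps_bit)
next
  case (cons c cs)
  have "q_cf q_last_minus cs $ 0 = 1"
    using cons by (intro q_cf_nth_0) (auto simp: q_last_minus_def coeff_q_int fps_X_power_mult_nth)
  then show ?case using cons by (simp add: q_cf_Cons fps_mod2_q_cf_step)
qed

text \<open>The code of a point can be read off its value modulo 2. As $1/y = 1 + O(q)$, the term
  $q^{c-1}/y$ cancels the last power in $[c]_q$, and the leading run of ones in the coefficients of
  $[c]_q + q^{c-1}/y$ has length exactly $c - 1$.\<close>

lemma mod2_step_inj:
  assumes "mod2_step c y = mod2_step d z" "2 \<le> c" "2 \<le> d" "y $ 0 = 1" "z $ 0 = 1"
  shows "c = d \<and> y = z"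
proof -
  have i0: "inverse y $ 0 = 1" "inverse z $ 0 = 1" using assms by auto
  have *: "False" if "mod2_step c y = mod2_step d z" "2 \<le> c" "c < d" "inverse y $ 0 = 1" for c d y z
  proof -
    have "mod2_step c y $ (c - 1) = 0" using that(2-)
      by (simp add: mod2_step_def coeff_q_int fps_X_power_mult_nth)
    moreover have "mod2_step d z $ (c - 1) = 1" using that(2-)
      by (simp add: mod2_step_def coeff_q_int fps_X_power_mult_nth) arith
    ultimately show False using that(1) by simp
  qed
  have cd: "c = d" using *[of c y d z] *[of d z c y] assms i0 by (metis linorder_neqE_nat)
  then have "inverse y = inverse z" using assms(1) by (simp add: mod2_step_def)
  then have "inverse (inverse y) = inverse (inverse z)" by simp
  then have "y = z" using assms by (simp add: fps_inverse_idempotent)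
  with cd show ?thesis by simp
qed

lemma code_value_inj:
  assumes "code_value c = code_value d" "\<forall>a\<in>sset c. 2 \<le> a" "\<forall>a\<in>sset d. 2 \<le> a"
  shows "c = d"
  using assms
proof (coinduction arbitrary: c d)
  case Eq_stream
  have "mod2_step (shd c) (code_value (stl c)) = mod2_step (shd d) (code_value (stl d))"
    using Eq_stream by (simp add: code_value_unfold)
  then have "shd c = shd d \<and> code_value (stl c) = code_value (stl d)"
    using Eq_stream digits_stl
    by (intro mod2_step_inj code_value_nth_0) (auto simp: shd_sset)
  then show ?case using Eq_stream digits_stl by blast
qed

section \<open>Values of points in terms of codes\<close>

lemma fls_mod2_fps_to_fls: "fls_mod2 (fps_to_fls f) = fps_to_fls (fps_mod2 f)"
proof -
  have "(\<lambda>k. of_int (fls_nth (fps_to_fls f) k)) = (\<lambda>k. if k < 0 then 0 else fps_mod2 f $ nat k)"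
    by auto
  then show ?thesis by (simp only: fls_mod2_def fps_to_fls_def[of "fps_mod2 f"])
qed

lemma q_real_ge1_iff: "1 \<le> x \<Longrightarrow> q_real x = fps_to_fls (q_real_ge1 x)"
  by (simp add: q_real_def nat_le_0 le_floor_iff)

lemma q_real_expansion:
  "infinite_expansion x c \<Longrightarrow> 1 \<le> x \<Longrightarrow> fls_mod2 (q_real x) = fps_to_fls (code_value c)"
  by (simp add: q_real_ge1_iff q_real_ge1_eq fls_mod2_fps_to_fls code_value_def)

lemma has_code_Infinite:
  assumes "has_code x (Infinite c)"
  shows "\<forall>a\<in>sset c. 2 \<le> a" and "Phi2 x = Some (fps_to_fls (code_value c))"
proof -
  have "(\<forall>a\<in>sset c. 2 \<le> a) \<and> Phi2 x = Some (fps_to_fls (code_value c))"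
    using assms
  proof cases
    case 2
    then show ?thesis using q_real_expansion[OF infinite_expansion_one]
      infinite_expansion_one by (simp add: infinite_expansion_def)
  next
    case (4 r cs d)
    have "infinite_expansion (hj (cs @ [d])) c"
      using 4 infinite_expansion_hj[of cs d] by (simp add: finite_expansion_def)
    moreover have "hj (cs @ [d]) = (of_rat r :: real)"
      using 4 of_rat_hj[of "cs @ [d]", where ?'a = real] by (simp add: finite_expansion_def)
    moreover have "1 \<le> (of_rat r :: real)" using 4 by simp
    ultimately show ?thesis using 4 q_real_expansion[of "of_rat r" c]
      by (simp add: infinite_expansion_def)
  next
    case (5 y)
    then show ?thesis using q_real_expansion[of "real_of_irrational y" c]
      by (simp add: infinite_expansion_def)
  qed
  then show "\<forall>a\<in>sset c. 2 \<le> a" and "Phi2 x = Some (fps_to_fls (code_value c))" by auto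
qed

lemma q_rat_minus_gt1_eq:
  "finite_expansion r cs \<Longrightarrow> q_rat_minus_gt1 r = q_cf q_last_minus cs"
  using finite_expansion_unique by (auto simp: q_rat_minus_gt1_def intro!: arg_cong[of _ _ "q_cf q_last_minus"])

lemma q_rat_minus_gt1_iff: "1 < r \<Longrightarrow> q_rat_minus r = fps_to_fls (q_rat_minus_gt1 r)"
proof -
  assume "1 < r"
  then have "2 \<le> \<lceil>r\<rceil>" by (simp add: le_ceiling_iff)
  then show ?thesis by (simp add: q_rat_minus_def)
qed

lemma has_code_Terminating:
  assumes "has_code x (Terminating bs)"
  shows "\<forall>a\<in>set bs. 2 \<le> a"
    and "Phi2 x = Some (fps_to_fls (foldr mod2_step bs (inverse (1 - fps_X))))"
proof -
  have "(\<forall>a\<in>set bs. 2 \<le> a) \<and> Phi2 x = Some (fps_to_fls (foldr mod2_step bs (inverse (1 - fps_X))))"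
    using assms
  proof cases
    case 1
    have "(1 - fps_X) * inverse (1 - fps_X) = (1 :: bit fps)" by (intro inverse_mult_eq_1') simp
    then have "(1 - fls_X) * fps_to_fls (inverse (1 - fps_X)) = (1 :: bit fls)"
      by (metis fls_times_fps_to_fls fps_X_to_fls fps_one_to_fls fps_to_fls_minus)
    moreover from this have "1 - fls_X \<noteq> (0 :: bit fls)" by auto
    ultimately show ?thesis using 1 by (simp add: H2_def field_simps)
  next
    case (3 r)
    then show ?thesis using q_cf_minus_mod2[of bs]
      by (simp add: finite_expansion_def q_rat_minus_gt1_iff q_rat_minus_gt1_eq fls_mod2_fps_to_fls)
  qed
  then show "\<forall>a\<in>set bs. 2 \<le> a"
    and "Phi2 x = Some (fps_to_fls (foldr mod2_step bs (inverse (1 - fps_X))))" by auto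
qed

lemma RC_one_cases:
  assumes "x \<in> RC_one"
  obtains "x = PosInf" | r where "x = RatMinus r" "1 < r" | r where "x = RatPlus r" "1 \<le> r"
    | y where "x = Irr y" "1 < real_of_irrational y"
proof (cases x)
  case (Irr y)
  have "real_of_irrational y \<noteq> 1" using of_rat_neq_irrational[of 1 y] by simp
  then show ?thesis using Irr assms that(4)[of y]
    by (auto simp: RC_one_def less_eq_cantor_line_def one_ereal_def)
qed (use assms that in \<open>auto simp: RC_one_def less_eq_cantor_line_def one_ereal_def\<close>)

lemma RC_one_has_code:
  assumes "x \<in> RC_one"
  shows "\<exists>w. has_code x w"
  using assms
proof (cases rule: RC_one_cases)
  case 1
  then show ?thesis using has_code.intros(1) by auto
next
  case (2 r)
  then show ?thesis using finite_expansion_exists[of r] has_code.intros(3) by blast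
next
  case (3 r)
  show ?thesis
  proof (cases "r = 1")
    case True
    then show ?thesis using 3 has_code.intros(2) by blast
  next
    case False
    then have "1 < r" using 3 by simp
    then obtain cs where cs: "finite_expansion r cs" using finite_expansion_exists[of r] by auto
    then have "finite_expansion r (butlast cs @ [last cs])" by (simp add: finite_expansion_def)
    then show ?thesis using has_code.intros(4)[OF \<open>1 < r\<close>] 3 by blast
  qed
next
  case (4 y)
  then show ?thesis using infinite_expansion_exists[of "real_of_irrational y"] has_code.intros(5)
    by (meson less_imp_le)
qed

section \<open>The matrix action and its fixed points\<close>

abbreviation (input) "mA bs \<equiv> vec_nth (vec_nth (Mprod bs) 1) 1"
abbreviation (input) "mB bs \<equiv> vec_nth (vec_nth (Mprod bs) 1) 2"
abbreviation (input) "mC bs \<equiv> vec_nth (vec_nth (Mprod bs) 2) 1"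
abbreviation (input) "mD bs \<equiv> vec_nth (vec_nth (Mprod bs) 2) 2"

lemma Mprod_Nil: "mA [] = 1" "mB [] = 0" "mC [] = 0" "mD [] = 1"
  by (simp_all add: Mprod_def mat_def)

lemma Mprod_Cons:
  "mA (b # bs) = q_int b * mA bs + monom 1 (b - 1) * mC bs"
  "mB (b # bs) = q_int b * mB bs + monom 1 (b - 1) * mD bs"
  "mC (b # bs) = mA bs"
  "mD (b # bs) = mB bs"
  by (simp_all add: Mprod_def Mmat_def matrix_matrix_mult_def sum_2)

lemma Mprod_coeff_0:
  assumes "cs \<noteq> []" "\<forall>a\<in>set cs. 2 \<le> a"
  shows "coeff (mA cs) 0 = 1 \<and> coeff (mB cs) 0 = 0 \<and> coeff (mC cs) 0 = 1 \<and> coeff (mD cs) 0 = 0"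
  using assms
  by (induction cs rule: list_nonempty_induct)
    (auto simp: Mprod_Cons Mprod_Nil coeff_mult coeff_q_int)

lemma fps_of_poly_eq_0_iff [simp]: "fps_of_poly p = 0 \<longleftrightarrow> p = 0"
  using fps_of_poly_eq_iff[of p 0] by simp

lemmas fps_of_poly_hom = fps_of_poly_add fps_of_poly_mult fps_of_poly_monom'

text \<open>The matrices act as the steps do: $M_b$ sends the column $(y, 1)$ to $y$ times the column
  $([b]_q + q^{b-1}/y,\, 1)$. The denominator picks up a factor with constant term 1 at each digit,
  hence is never zero.\<close>

lemma Mprod_action:
  assumes "\<forall>a\<in>set bs. 2 \<le> a" "y $ 0 = 1"
  defines "d \<equiv> \<lambda>bs. fps_of_poly (mC bs) * y + fps_of_poly (mD bs)"
  shows "fps_of_poly (mA bs) * y + fps_of_poly (mB bs) = d bs * foldr mod2_step bs y"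
    and "d bs $ 0 = 1"
proof -
  have "foldr mod2_step bs y $ 0 = 1 \<and> d bs $ 0 = 1 \<and>
      fps_of_poly (mA bs) * y + fps_of_poly (mB bs) = d bs * foldr mod2_step bs y"
    using assms(1)
  proof (induction bs)
    case Nil
    then show ?case using assms(2) by (simp add: Mprod_Nil d_def)
  next
    case (Cons b bs)
    define t where "t = foldr mod2_step bs y"
    define n where "n = fps_of_poly (mA bs) * y + fps_of_poly (mB bs)"
    have IH: "t $ 0 = 1" "d bs $ 0 = 1" "n = d bs * t" using Cons by (auto simp: t_def n_def)
    have "t * inverse t = 1" using IH by (intro inverse_mult_eq_1') simp
    have "fps_of_poly (mA (b # bs)) * y + fps_of_poly (mB (b # bs))
        = fps_of_poly (q_int b) * n + fps_X ^ (b - 1) * d bs"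
      by (simp add: Mprod_Cons fps_of_poly_hom n_def d_def algebra_simps)
    also have "\<dots> = fps_of_poly (q_int b) * n + fps_X ^ (b - 1) * (d bs * (t * inverse t))"
      by (simp only: \<open>t * inverse t = 1\<close> mult_1_right)
    also have "\<dots> = n * mod2_step b t" by (simp add: IH mod2_step_def algebra_simps)
    also have "n = d (b # bs)" by (simp add: d_def n_def Mprod_Cons)
    finally have "fps_of_poly (mA (b # bs)) * y + fps_of_poly (mB (b # bs)) = d (b # bs) * mod2_step b t" .
    moreover have "d (b # bs) $ 0 = 1" using IH by (simp add: \<open>n = d (b # bs)\<close>[symmetric])
    ultimately show ?case using Cons.prems by (simp add: t_def mod2_step_nth_0)
  qed
  then show "fps_of_poly (mA bs) * y + fps_of_poly (mB bs) = d bs * foldr mod2_step bs y"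
    and "d bs $ 0 = 1" by auto
qed

text \<open>The polynomials $N$ and $\Delta$ arise by clearing the denominator of the tail $y = P/Q$.\<close>

lemma Num_Delta:
  assumes "\<forall>a\<in>set bs. 2 \<le> a" "y $ 0 = 1" "Q \<noteq> 0" "fps_of_poly P = fps_of_poly Q * y"
  shows "Delta bs P Q \<noteq> 0"
    and "fps_of_poly (Num bs P Q) = fps_of_poly (Delta bs P Q) * foldr mod2_step bs y"
proof -
  define d where "d = fps_of_poly (mC bs) * y + fps_of_poly (mD bs)"
  have d: "fps_of_poly (Delta bs P Q) = fps_of_poly Q * d"
    by (simp add: Delta_def fps_of_poly_hom assms(4) d_def algebra_simps)
  have "d \<noteq> 0" using Mprod_action(2)[OF assms(1,2)] unfolding d_def
    by (metis fps_zero_nth zero_neq_one)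
  then have "fps_of_poly (Delta bs P Q) \<noteq> 0" using assms(3) d by simp
  then show "Delta bs P Q \<noteq> 0" by auto
  have "fps_of_poly (Num bs P Q) = fps_of_poly Q * (fps_of_poly (mA bs) * y + fps_of_poly (mB bs))"
    by (simp add: Num_def fps_of_poly_hom assms(4) algebra_simps)
  then show "fps_of_poly (Num bs P Q) = fps_of_poly (Delta bs P Q) * foldr mod2_step bs y"
    using Mprod_action(1)[OF assms(1,2)] d by (simp add: d_def)
qed

lemma unit_root_iff:
  "unit_root cs y \<longleftrightarrow> y $ 0 = 1 \<and>
     fps_of_poly (mC cs) * y\<^sup>2 + fps_of_poly (mA cs + mD cs) * y + fps_of_poly (mB cs) = 0"
  by (simp add: unit_root_def period_poly_def Let_def map_poly_pCons power2_eq_square algebra_simps)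

text \<open>Modulo $q$ the polynomial of a period is $Y^2 + Y$. So in the factorization
  $(Y - Z)\,(C(Y+Z) + A + D)$ of the difference of its values at two roots $Y$, $Z$ with constant
  term 1, the second factor has constant term 1 and is not zero.\<close>

lemma unit_root_unique:
  assumes "cs \<noteq> []" "\<forall>a\<in>set cs. 2 \<le> a" "unit_root cs y" "unit_root cs z"
  shows "y = z"
proof -
  define c s b where "c = fps_of_poly (mC cs)" and "s = fps_of_poly (mA cs + mD cs)"
    and "b = fps_of_poly (mB cs)"
  have y: "y $ 0 = 1" "c * y\<^sup>2 + s * y + b = 0" and z: "z $ 0 = 1" "c * z\<^sup>2 + s * z + b = 0"
    using assms(3,4) by (auto simp: unit_root_iff c_def s_def b_def)
  have "(y - z) * (c * (y + z) + s) = (c * y\<^sup>2 + s * y + b) - (c * z\<^sup>2 + s * z + b)"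
    by (simp add: power2_eq_square algebra_simps)
  then have "(y - z) * (c * (y + z) + s) = 0" using y z by simp
  moreover have "(c * (y + z) + s) $ 0 = 1"
    using Mprod_coeff_0[OF assms(1,2)] y z by (simp add: c_def s_def)
  then have "c * (y + z) + s \<noteq> 0" by (metis fps_zero_nth zero_neq_one)
  ultimately show ?thesis by simp
qed

text \<open>A purely periodic code is its own tail, so its value is a fixed point of the matrix of the
  period.\<close>

lemma unit_root_code_value_cycle:
  assumes "cs \<noteq> []" "\<forall>a\<in>set cs. 2 \<le> a"
  shows "unit_root cs (code_value (cycle cs))"
proof -
  define y where "y = code_value (cycle cs)"
  have dig: "\<forall>a\<in>sset (cycle cs). 2 \<le> a" using assms by simp
  have y0: "y $ 0 = 1" using dig by (simp add: y_def code_value_nth_0)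
  have "foldr mod2_step cs y = y"
    using code_value_shift[OF assms(2) dig] cycle_decomp[OF assms(1)] by (simp add: y_def)
  then have "fps_of_poly (mA cs) * y + fps_of_poly (mB cs)
      = (fps_of_poly (mC cs) * y + fps_of_poly (mD cs)) * y"
    using Mprod_action(1)[OF assms(2) y0] by simp
  then have "(fps_of_poly (mC cs) * y + fps_of_poly (mD cs)) * y
      + (fps_of_poly (mA cs) * y + fps_of_poly (mB cs)) = 0"
    by (metis add_self_fps_bit)
  then show ?thesis using y0
    by (simp add: unit_root_iff fps_of_poly_hom power2_eq_square algebra_simps flip: y_def)
qed

section \<open>Splitting of the polynomial of a period\<close>

lemma splits_quadratic_iff:
  fixes a b c :: "'a :: field"
  assumes "c \<noteq> 0"
  shows "splits [:b, a, c:] \<longleftrightarrow> (\<exists>y. c * y\<^sup>2 + a * y + b = 0)"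
proof
  assume "splits [:b, a, c:]"
  then obtain ys where ys: "[:b, a, c:] = smult (lead_coeff [:b, a, c:]) (\<Prod>y\<leftarrow>ys. [:- y, 1:])"
    by (auto simp: splits_def)
  have "ys \<noteq> []"
  proof
    assume "ys = []"
    then have "degree [:b, a, c:] = 0" by (subst ys) simp
    then show False using assms by simp
  qed
  then have "poly [:b, a, c:] (hd ys) = 0" by (subst ys) (cases ys; simp)
  then show "\<exists>y. c * y\<^sup>2 + a * y + b = 0"
    by (auto simp: power2_eq_square algebra_simps)
next
  assume "\<exists>y. c * y\<^sup>2 + a * y + b = 0"
  then obtain y where y: "c * y\<^sup>2 + a * y + b = 0" by auto
  \<comment> \<open>The two roots add up to $-a/c$.\<close>
  define z where "z = - a / c - y"
  have a: "a = - (c * z) - c * y" using assms by (simp add: z_def field_simps)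
  have "c * y\<^sup>2 + a * y + b = b - c * (y * z)" by (simp add: a power2_eq_square algebra_simps)
  then have "b = c * (y * z)" using y by simp
  moreover note a
  ultimately have "[:b, a, c:] = smult c (\<Prod>y\<leftarrow>[y, z]. [:- y, 1:])"
    by (simp add: right_diff_distrib)
  then show "splits [:b, a, c:]" using assms by (auto simp: splits_def intro!: exI[of _ "[y, z]"])
qed

text \<open>In characteristic 2 the substitution $y = a u/c$ turns $c y^2 + a y + b$ into
  $\frac{a^2}{c}\,(u^2 + u + \frac{bc}{a^2})$.\<close>

lemma quadratic_root_iff_Artin_Schreier:
  fixes a b c :: "'a :: field"
  assumes "(1 + 1 :: 'a) = 0" "c \<noteq> 0" "a \<noteq> 0"
  shows "(\<exists>y. c * y\<^sup>2 + a * y + b = 0) \<longleftrightarrow> (\<exists>u. b * c / a\<^sup>2 = u\<^sup>2 + u)"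
proof -
  have "x + x = 0" for x :: 'a using assms(1) by (metis distrib_left mult.right_neutral mult_zero_right)
  then have minus: "x + y = 0 \<longleftrightarrow> y = x" for x y :: 'a by (metis add_left_cancel)
  have eq: "c * (a * u / c)\<^sup>2 + a * (a * u / c) + b = a\<^sup>2 / c * ((u\<^sup>2 + u) + b * c / a\<^sup>2)" for u
    using assms by (simp add: field_simps power2_eq_square)
  have iff: "c * (a * u / c)\<^sup>2 + a * (a * u / c) + b = 0 \<longleftrightarrow> b * c / a\<^sup>2 = u\<^sup>2 + u" for u
    unfolding eq using assms minus by simp
  have "y = a * (c * y / a) / c" for y using assms by simp
  then show ?thesis using iff by metis
qed

lemma to_F2_q_hom:
  "to_F2_q 0 = 0" "to_F2_q 1 = 1"
  "to_F2_q (p + r) = to_F2_q p + to_F2_q r" "to_F2_q (p * r) = to_F2_q p * to_F2_q r"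
  "to_F2_q p = 0 \<longleftrightarrow> p = 0"
  by (simp_all add: to_F2_q_def Zero_fract_def One_fract_def eq_fract)

lemma period_quadratic_nonzero:
  assumes "cs \<noteq> []" "\<forall>a\<in>set cs. 2 \<le> a"
  shows "mC cs \<noteq> 0" "mA cs + mD cs \<noteq> 0"
proof -
  have "coeff (mC cs) 0 = 1" "coeff (mA cs + mD cs) 0 = 1"
    using Mprod_coeff_0[OF assms] by simp_all
  then show "mC cs \<noteq> 0" "mA cs + mD cs \<noteq> 0" by (metis coeff_0 zero_neq_one)+
qed

lemma period_splits_iff_root:
  assumes "cs \<noteq> []" "\<forall>a\<in>set cs. 2 \<le> a"
  shows "period_splits cs \<longleftrightarrow>
    (\<exists>y. to_F2_q (mC cs) * y\<^sup>2 + to_F2_q (mA cs + mD cs) * y + to_F2_q (mB cs) = 0)"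
proof -
  have "map_poly to_F2_q (period_poly cs)
      = [:to_F2_q (mB cs), to_F2_q (mA cs + mD cs), to_F2_q (mC cs):]"
    by (simp add: period_poly_def Let_def map_poly_pCons to_F2_q_hom(1))
  then show ?thesis
    using splits_quadratic_iff[of "to_F2_q (mC cs)"] period_quadratic_nonzero[OF assms]
    by (simp add: period_splits_def to_F2_q_hom(5))
qed

lemma period_splits_iff_Artin_Schreier:
  assumes "cs \<noteq> []" "\<forall>a\<in>set cs. 2 \<le> a"
  shows "period_splits cs \<longleftrightarrow>
    to_F2_q (mB cs * mC cs) / to_F2_q ((mA cs + mD cs)\<^sup>2) \<in> {u\<^sup>2 + u | u. True}"
proof -
  have char2: "(1 + 1 :: bit poly fract) = 0"
    by (metis add_self_poly_bit to_F2_q_hom(1-3))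
  have sq: "to_F2_q (p\<^sup>2) = (to_F2_q p)\<^sup>2" for p
    by (simp add: power2_eq_square to_F2_q_hom(4))
  have "to_F2_q (mC cs) \<noteq> 0" "to_F2_q (mA cs + mD cs) \<noteq> 0"
    using period_quadratic_nonzero[OF assms] to_F2_q_hom(5) by blast+
  from quadratic_root_iff_Artin_Schreier[OF char2 this] show ?thesis
    unfolding period_splits_iff_root[OF assms] sq to_F2_q_hom(4) by blast
qed

definition rational_fps :: "bit fps \<Rightarrow> bool" where
  "rational_fps y \<longleftrightarrow> (\<exists>P Q. Q \<noteq> 0 \<and> fps_of_poly P = fps_of_poly Q * y)"

lemma to_F2_q_Fract:
  assumes "Q \<noteq> 0"
  shows "to_F2_q c * (Fract P Q)\<^sup>2 + to_F2_q a * Fract P Q + to_F2_q b = 0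
     \<longleftrightarrow> c * P\<^sup>2 + a * P * Q + b * Q\<^sup>2 = 0"
proof -
  have "to_F2_q c * (Fract P Q)\<^sup>2 + to_F2_q a * Fract P Q + to_F2_q b
      = Fract (c * P\<^sup>2 + a * P * Q + b * Q\<^sup>2) (Q\<^sup>2)"
    using assms by (simp add: to_F2_q_def power2_eq_square eq_fract) algebra
  then show ?thesis using assms by (simp add: Zero_fract_def eq_fract)
qed

text \<open>The root in $1 + q\,\mathbb F_2[[q]]$ always exists as a power series. One rational root of
  a quadratic polynomial makes both roots rational, and this power series is one of the two.\<close>

lemma period_splits_iff_rational:
  assumes "cs \<noteq> []" "\<forall>a\<in>set cs. 2 \<le> a"
  shows "period_splits cs \<longleftrightarrow> rational_fps (code_value (cycle cs))"
proof -
  define y where "y = code_value (cycle cs)"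
  define c s b where "c = fps_of_poly (mC cs)" and "s = fps_of_poly (mA cs + mD cs)"
    and "b = fps_of_poly (mB cs)"
  have y: "c * y\<^sup>2 + s * y + b = 0"
    using unit_root_code_value_cycle[OF assms] by (simp add: unit_root_iff y_def c_def s_def b_def)
  have "period_splits cs \<longleftrightarrow>
      (\<exists>P Q. Q \<noteq> 0 \<and> mC cs * P\<^sup>2 + (mA cs + mD cs) * P * Q + mB cs * Q\<^sup>2 = 0)"
    (is "_ \<longleftrightarrow> ?R")
  proof
    assume "period_splits cs"
    then obtain f where f: "to_F2_q (mC cs) * f\<^sup>2 + to_F2_q (mA cs + mD cs) * f + to_F2_q (mB cs) = 0"
      unfolding period_splits_iff_root[OF assms] by blast
    obtain P Q where "f = Fract P Q" "Q \<noteq> 0" by (cases f rule: Fract_cases) auto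
    then show ?R using f to_F2_q_Fract[of Q] by blast
  next
    assume ?R
    then show "period_splits cs" unfolding period_splits_iff_root[OF assms] using to_F2_q_Fract by blast
  qed
  also have "\<dots> \<longleftrightarrow> (\<exists>P Q. Q \<noteq> 0 \<and> c * (fps_of_poly P)\<^sup>2 + s * fps_of_poly P * fps_of_poly Q
      + b * (fps_of_poly Q)\<^sup>2 = 0)"
    unfolding c_def s_def b_def
    by (simp only: fps_of_poly_eq_iff fps_of_poly_0[symmetric]
        flip: fps_of_poly_power fps_of_poly_mult fps_of_poly_add)
  also have "\<dots> \<longleftrightarrow> rational_fps y"
  proof
    assume "rational_fps y"
    then obtain P Q where "Q \<noteq> 0" and P: "fps_of_poly P = fps_of_poly Q * y"
      by (auto simp: rational_fps_def)
    moreover have "c * (fps_of_poly P)\<^sup>2 + s * fps_of_poly P * fps_of_poly Q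
      + b * (fps_of_poly Q)\<^sup>2 = (fps_of_poly Q)\<^sup>2 * (c * y\<^sup>2 + s * y + b)"
      unfolding P by (simp add: power2_eq_square algebra_simps)
    ultimately show "\<exists>P Q. Q \<noteq> 0 \<and> c * (fps_of_poly P)\<^sup>2 + s * fps_of_poly P * fps_of_poly Q
      + b * (fps_of_poly Q)\<^sup>2 = 0" using y by (metis mult_zero_right)
  next
    assume "\<exists>P Q. Q \<noteq> 0 \<and> c * (fps_of_poly P)\<^sup>2 + s * fps_of_poly P * fps_of_poly Q
      + b * (fps_of_poly Q)\<^sup>2 = 0"
    then obtain P Q where Q: "Q \<noteq> 0" and eq: "c * (fps_of_poly P)\<^sup>2
      + s * fps_of_poly P * fps_of_poly Q + b * (fps_of_poly Q)\<^sup>2 = 0" by auto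
    define p q where "p = fps_of_poly P" and "q = fps_of_poly Q"
    \<comment> \<open>Two roots $P/Q$ and $y$ of the quadratic satisfy $P/Q = y$ or $P/Q + y = s/c$.\<close>
    have "(p - q * y) * (c * p + s * q + c * (q * y))
        = (c * p\<^sup>2 + s * p * q + b * q\<^sup>2) - q\<^sup>2 * (c * y\<^sup>2 + s * y + b)"
      by (simp add: power2_eq_square algebra_simps)
    then have "(p - q * y) * (c * p + s * q + c * (q * y)) = 0" using eq y by (simp add: p_def q_def)
    then have "p - q * y = 0 \<or> (c * p + s * q) - c * (q * y) = 0"
      unfolding minus_fps_bit[of "c * p + s * q"] by simp
    then consider "p = q * y" | "c * p + s * q = c * (q * y)" by auto
    then show "rational_fps y"
    proof cases
      case 1
      then show ?thesis using Q unfolding rational_fps_def p_def q_def by blast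
    next
      case 2
      then have "fps_of_poly (mC cs * P + (mA cs + mD cs) * Q) = fps_of_poly (mC cs * Q) * y"
        by (simp add: c_def s_def p_def q_def fps_of_poly_hom algebra_simps)
      moreover have "mC cs * Q \<noteq> 0" using Q period_quadratic_nonzero[OF assms] by simp
      ultimately show ?thesis unfolding rational_fps_def by blast
    qed
  qed
  finally show ?thesis by (simp add: y_def)
qed

text \<open>A denominator of least degree cannot share a nonconstant factor with its numerator.\<close>

lemma rational_fps_lowest_terms:
  assumes "rational_fps y"
  shows "\<exists>P Q. coprime P Q \<and> Q \<noteq> 0 \<and> fps_of_poly P = fps_of_poly Q * y"
proof -
  define R where "R = (\<lambda>Q. Q \<noteq> 0 \<and> (\<exists>P. fps_of_poly P = fps_of_poly Q * y))"
  obtain Q0 where "R Q0" using assms by (auto simp: rational_fps_def R_def)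
  then obtain Q where Q: "R Q" and min: "\<And>Q'. R Q' \<Longrightarrow> degree Q \<le> degree Q'"
    using ex_has_least_nat[of R Q0 degree] by blast
  then obtain P where P: "Q \<noteq> 0" "fps_of_poly P = fps_of_poly Q * y" by (auto simp: R_def)
  have "coprime P Q"
  proof (rule coprimeI)
    fix d assume "d dvd P" "d dvd Q"
    then obtain P' Q' where d: "P = d * P'" "Q = d * Q'" by (auto elim!: dvdE)
    have "fps_of_poly d * fps_of_poly P' = fps_of_poly d * (fps_of_poly Q' * y)"
      using P by (simp add: d fps_of_poly_mult mult.assoc)
    moreover have "fps_of_poly d \<noteq> 0" using P d by auto
    ultimately have "fps_of_poly P' = fps_of_poly Q' * y" by simp
    then have "R Q'" using P d by (auto simp: R_def)
    then have "degree Q \<le> degree Q'" by (rule min)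
    moreover have "degree Q = degree d + degree Q'" using P d by (simp add: degree_mult_eq)
    ultimately have "degree d = 0" by simp
    moreover have "d \<noteq> 0" using P d by auto
    ultimately show "is_unit d" by (simp add: is_unit_iff_degree)
  qed
  then show ?thesis using P by blast
qed

section \<open>Rational values have terminating or eventually periodic codes\<close>

lemma finite_bit_polys_degree_le: "finite {p :: bit poly. degree p \<le> h}"
proof -
  have "{p :: bit poly. degree p \<le> h} \<subseteq> Poly ` {xs. set xs \<subseteq> {0, 1} \<and> length xs \<le> Suc h}"
  proof
    fix p :: "bit poly" assume "p \<in> {p. degree p \<le> h}"
    then have "length (coeffs p) \<le> Suc h" by (auto simp: coeffs_def)
    moreover have "set (coeffs p) \<subseteq> {0, 1}" using bit_not_zero_iff by blast
    ultimately show "p \<in> Poly ` {xs. set xs \<subseteq> {0, 1} \<and> length xs \<le> Suc h}"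
      by (intro image_eqI[of _ _ "coeffs p"]) auto
  qed
  then show ?thesis by (rule finite_subset) (intro finite_imageI finite_lists_length_le, simp)
qed

text \<open>From $P/Q = [c]_q + q^{c-1}/y'$ one gets $y' = Q / ((P + [c]_q Q)/q^{c-1})$. The division by
  $q^{c-1}$ compensates the growth of the degree caused by $[c]_q$, so that the shift of the code
  does not increase the height of a rational value.\<close>

lemma rational_tail:
  assumes "\<forall>a\<in>sset c. 2 \<le> a" "fps_of_poly P = fps_of_poly Q * code_value c" "Q \<noteq> 0"
    "degree P \<le> h" "degree Q \<le> h"
  shows "\<exists>P' Q'. fps_of_poly P' = fps_of_poly Q' * code_value (stl c) \<and> Q' \<noteq> 0 \<and>
    degree P' \<le> h \<and> degree Q' \<le> h"
proof -
  define k y where "k = shd c - 1" and "y = code_value (stl c)"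
  define R where "R = P + q_int (shd c) * Q"
  define Q' where "Q' = poly_shift k R"
  have "y $ 0 = 1" using assms(1) by (simp add: y_def code_value_nth_0 digits_stl)
  then have inv: "inverse y * y = 1" by (intro inverse_mult_eq_1) simp
  have "fps_of_poly R = fps_of_poly Q * (code_value c + fps_of_poly (q_int (shd c)))"
    by (simp add: R_def fps_of_poly_hom assms(2) algebra_simps)
  also have "code_value c + fps_of_poly (q_int (shd c))
      = fps_X ^ k * inverse y + (fps_of_poly (q_int (shd c)) + fps_of_poly (q_int (shd c)))"
    unfolding code_value_unfold[OF assms(1)] mod2_step_def k_def y_def by (simp only: ac_simps)
  finally have R: "fps_of_poly R = fps_X ^ k * (fps_of_poly Q * inverse y)"
    by (simp add: algebra_simps)
  have "fps_of_poly Q' = fps_of_poly Q * inverse y"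
    by (intro fps_ext) (simp add: Q'_def R fps_X_power_mult_nth)
  then have Q': "fps_of_poly Q = fps_of_poly Q' * y" by (simp add: mult.assoc inv)
  have "degree (q_int (shd c) :: bit poly) \<le> k"
    by (intro degree_le) (auto simp: coeff_q_int k_def)
  then have "degree R \<le> h + k"
    unfolding R_def using assms(4,5)
    by (intro degree_add_le order_trans[OF degree_mult_le]) auto
  then have "degree Q' \<le> h"
    by (intro degree_le) (auto simp: Q'_def coeff_poly_shift intro!: coeff_eq_0)
  moreover have "Q' \<noteq> 0" using Q' assms(3) by auto
  ultimately show ?thesis using Q' assms(5) unfolding y_def by blast
qed

lemma rational_fps_sdrop:
  assumes "rational_fps (code_value c)" "\<forall>a\<in>sset c. 2 \<le> a"
  shows "\<exists>h. \<forall>n. \<exists>P Q. fps_of_poly P = fps_of_poly Q * code_value (sdrop n c) \<and> Q \<noteq> 0 \<and>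
    degree P \<le> h \<and> degree Q \<le> h"
proof -
  obtain P Q where "Q \<noteq> 0" "fps_of_poly P = fps_of_poly Q * code_value c"
    using assms(1) by (auto simp: rational_fps_def)
  define h where "h = max (degree P) (degree Q)"
  have "\<exists>P Q. fps_of_poly P = fps_of_poly Q * code_value (sdrop n c) \<and> Q \<noteq> 0 \<and>
    degree P \<le> h \<and> degree Q \<le> h" for n
  proof (induction n)
    case 0
    show ?case using \<open>Q \<noteq> 0\<close> \<open>fps_of_poly P = _\<close>
      by (intro exI[of _ P] exI[of _ Q]) (simp add: h_def)
  next
    case (Suc n)
    then show ?case using rational_tail[OF digits_sdrop[OF assms(2)]]
      by (metis sdrop.simps(2) sdrop_stl)
  qed
  then show ?thesis by blast
qed

lemma sdrop_eq_imp_cycle: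
  assumes "i < j" "sdrop i c = sdrop j c"
  shows "sdrop i c = cycle (stake (j - i) (sdrop i c))"
proof -
  define d where "d = sdrop i c"
  define u where "u = stake (j - i) d"
  have "sdrop (j - i) d = sdrop (i + (j - i)) c" by (simp only: d_def sdrop_add)
  then have "sdrop (j - i) d = d" using assms by (simp add: d_def)
  then have d: "d = u @- d" by (metis stake_sdrop u_def)
  have u: "u \<noteq> []" using assms(1) by (simp add: u_def)
  have "d !! n = cycle u !! n" for n
  proof (induction n rule: less_induct)
    case (less n)
    show ?case
    proof (cases "n < length u")
      case True
      then show ?thesis using d cycle_decomp[OF u] by (metis shift_snth_less)
    next
      case False
      then have "d !! (n - length u) = cycle u !! (n - length u)"
        using u by (intro less.IH) (cases u; simp)
      then show ?thesis using d cycle_decomp[OF u] False by (metis leI shift_snth_ge)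
    qed
  qed
  then have "d = cycle u" by (metis id_stake_snth_sdrop stream_smap_nats ext)
  then show ?thesis by (simp add: d_def u_def)
qed

text \<open>All tails of a code with rational value have values of bounded height. Over $\mathbb F_2$ there
  are only finitely many such values, so two tails have the same value, and hence the same digits.\<close>

lemma rational_fps_eventually_periodic:
  assumes "rational_fps (code_value c)" "\<forall>a\<in>sset c. 2 \<le> a"
  shows "\<exists>bs cs. cs \<noteq> [] \<and> c = bs @- cycle cs \<and> period_splits cs"
proof -
  obtain h where h: "\<And>n. \<exists>P Q. fps_of_poly P = fps_of_poly Q * code_value (sdrop n c) \<and> Q \<noteq> 0 \<and>
    degree P \<le> h \<and> degree Q \<le> h" using rational_fps_sdrop[OF assms] by blast
  then obtain P Q where PQ: "\<And>n. fps_of_poly (P n) = fps_of_poly (Q n) * code_value (sdrop n c)"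
    "\<And>n. Q n \<noteq> 0" "\<And>n. degree (P n) \<le> h" "\<And>n. degree (Q n) \<le> h" by metis
  have "(\<lambda>n. (P n, Q n)) ` UNIV \<subseteq> {p. degree p \<le> h} \<times> {p. degree p \<le> h}" using PQ by auto
  then have "finite (range (\<lambda>n. (P n, Q n)))"
    by (rule finite_subset) (intro finite_cartesian_product finite_bit_polys_degree_le)
  then have "\<not> inj (\<lambda>n. (P n, Q n))" using finite_imageD infinite_UNIV_nat by blast
  then obtain i j where ij: "i \<noteq> j" "P i = P j" "Q i = Q j" by (auto simp: inj_def)
  have wlog: "\<exists>bs cs. cs \<noteq> [] \<and> c = bs @- cycle cs \<and> period_splits cs"
    if "i < j" "P i = P j" "Q i = Q j" for i j
  proof -
    have "fps_of_poly (Q i) * code_value (sdrop i c) = fps_of_poly (Q i) * code_value (sdrop j c)"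
      using PQ(1)[of i] PQ(1)[of j] that(2,3) by metis
    moreover have "fps_of_poly (Q i) \<noteq> 0" using PQ(2) by simp
    ultimately have "code_value (sdrop i c) = code_value (sdrop j c)" by (metis mult_left_cancel)
    then have "sdrop i c = sdrop j c" using assms(2) by (intro code_value_inj digits_sdrop)
    define cs where "cs = stake (j - i) (sdrop i c)"
    have cyc: "sdrop i c = cycle cs"
      using sdrop_eq_imp_cycle[OF \<open>i < j\<close> \<open>sdrop i c = sdrop j c\<close>] by (simp add: cs_def)
    have "cs \<noteq> []" using \<open>i < j\<close> by (simp add: cs_def)
    moreover have "\<forall>a\<in>set cs. 2 \<le> a"
      unfolding cs_def by (intro digits_stake digits_sdrop assms)
    moreover have "rational_fps (code_value (cycle cs))"
      using PQ(1)[of i] PQ(2)[of i] unfolding cyc rational_fps_def by blast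
    ultimately have "period_splits cs" using period_splits_iff_rational by blast
    then show ?thesis using \<open>cs \<noteq> []\<close> cyc by (metis stake_sdrop)
  qed
  then show ?thesis using ij by (metis linorder_neqE_nat)
qed

section \<open>The two target sets\<close>

lemma poly_to_fls_hom:
  "poly_to_fls (p + r) = poly_to_fls p + poly_to_fls r"
  "poly_to_fls (p - r) = poly_to_fls p - poly_to_fls r"
  "poly_to_fls (p * r) = poly_to_fls p * poly_to_fls r"
  "poly_to_fls 1 = 1" "poly_to_fls (monom 1 1) = fls_X"
  "poly_to_fls p = poly_to_fls r \<longleftrightarrow> p = r"
  "poly_to_fls p = 0 \<longleftrightarrow> p = 0"
  by (simp_all add: poly_to_fls_def fps_of_poly_add fps_of_poly_diff fps_of_poly_mult
      fps_of_poly_monom' fls_times_fps_to_fls fps_of_poly_eq_iff)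

lemma fps_to_fls_eq_quotient_iff:
  assumes "D \<noteq> 0"
  shows "fps_to_fls y = poly_to_fls N / poly_to_fls D \<longleftrightarrow> fps_of_poly N = fps_of_poly D * y"
proof -
  have "poly_to_fls D \<noteq> 0" using assms by (simp add: poly_to_fls_hom)
  then have "fps_to_fls y = poly_to_fls N / poly_to_fls D
      \<longleftrightarrow> fps_to_fls (fps_of_poly D * y) = fps_to_fls (fps_of_poly N)"
    by (auto simp: field_simps fls_times_fps_to_fls poly_to_fls_def)
  then show ?thesis by (auto simp: fps_to_fls_eq_iff)
qed

lemma quotient_in_F2q_iff:
  assumes "D \<noteq> 0"
  shows "poly_to_fls N / poly_to_fls D \<in> F2q \<longleftrightarrow> D dvd N"
proof -
  have D: "poly_to_fls D \<noteq> 0" using assms by (simp add: poly_to_fls_hom)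
  have "poly_to_fls N / poly_to_fls D \<in> F2q \<longleftrightarrow> (\<exists>p. poly_to_fls N = poly_to_fls (D * p))"
    using D by (auto simp: F2q_def poly_to_fls_hom(3) field_simps)
  then show ?thesis by (auto simp: poly_to_fls_hom(6) dvd_def)
qed

lemma H2_plus_F2q_iff: "f \<in> H2_plus_F2q \<longleftrightarrow> f - H2 \<in> F2q"
  by (auto simp: H2_plus_F2q_def algebra_simps intro!: exI[of _ "f - H2"])

lemma quotient_in_H2_plus_F2q_iff:
  assumes "D \<noteq> 0"
  shows "poly_to_fls N / poly_to_fls D \<in> H2_plus_F2q
    \<longleftrightarrow> (1 - monom 1 1) * D dvd D + (1 - monom 1 1) * N"
proof -
  define v :: "bit poly" where "v = 1 - monom 1 1"
  have "coeff v 0 = 1" by (simp add: v_def)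
  then have v: "v \<noteq> 0" by auto
  then have nz: "poly_to_fls v \<noteq> 0" "poly_to_fls D \<noteq> 0" using assms by (auto simp: poly_to_fls_hom)
  have "H2 = 1 / poly_to_fls v" by (simp add: H2_def v_def poly_to_fls_hom del: One_nat_def)
  then have "poly_to_fls N / poly_to_fls D - H2 = poly_to_fls (v * N - D) / poly_to_fls (v * D)"
    using nz by (simp add: poly_to_fls_hom field_simps)
  also have "v * N - D = D + v * N" by (simp add: minus_poly_bit add.commute)
  finally show ?thesis
    using quotient_in_F2q_iff[of "v * D" "D + v * N"] v assms
    by (simp add: H2_plus_F2q_iff v_def)
qed

text \<open>In terms of coefficients the two target sets are the series that are eventually 0 and eventually
  1. This form makes the last part of the theorem and the invariance under translation evident.\<close>

lemma fps_to_fls_in_F2q_iff: "fps_to_fls y \<in> F2q \<longleftrightarrow> (\<forall>\<^sub>F j in sequentially. y $ j = 0)"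
proof
  assume "fps_to_fls y \<in> F2q"
  then obtain p where "y = fps_of_poly p" by (auto simp: F2q_def poly_to_fls_def fps_to_fls_eq_iff)
  then have "y $ j = 0" if "j > degree p" for j using that by (simp add: coeff_eq_0)
  then show "\<forall>\<^sub>F j in sequentially. y $ j = 0"
    using eventually_gt_at_top[of "degree p"] by (rule eventually_mono[rotated])
next
  assume "\<forall>\<^sub>F j in sequentially. y $ j = 0"
  then obtain n where n: "\<And>j. j \<ge> n \<Longrightarrow> y $ j = 0" by (auto simp: eventually_sequentially)
  have "y = fps_of_poly (truncate_fps n y)"
    using n by (intro fps_ext) (simp add: coeff_truncate_fps)
  then show "fps_to_fls y \<in> F2q" by (metis F2q_def poly_to_fls_def rangeI)
qed

lemma H2_eq: "H2 = fps_to_fls (Abs_fps (\<lambda>_. 1))"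
proof -
  define g :: "bit fps" where "g = Abs_fps (\<lambda>_. 1)"
  have "g - fps_X * g = 1"
  proof (rule fps_ext)
    show "(g - fps_X * g) $ n = 1 $ n" for n by (cases n) (simp_all add: g_def)
  qed
  then have "fps_to_fls g - fls_X * fps_to_fls g = 1"
    by (metis fls_times_fps_to_fls fps_X_to_fls fps_one_to_fls fps_to_fls_minus)
  then have "(1 - fls_X) * fps_to_fls g = 1" by (simp add: algebra_simps)
  moreover from this have "1 - fls_X \<noteq> (0 :: bit fls)" by auto
  ultimately show ?thesis by (simp add: H2_def g_def[symmetric] field_simps)
qed

lemma fps_to_fls_in_H2_plus_F2q_iff:
  "fps_to_fls y \<in> H2_plus_F2q \<longleftrightarrow> (\<forall>\<^sub>F j in sequentially. y $ j = 1)"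
proof -
  have "b - 1 = 0 \<longleftrightarrow> b = 1" for b :: bit by (rule right_minus_eq)
  then show ?thesis
    unfolding H2_plus_F2q_iff H2_eq fps_to_fls_minus[symmetric] fps_to_fls_in_F2q_iff
    by (simp del: minus_bit_def)
qed

section \<open>The tests\<close>

lemma value_tests:
  assumes "D \<noteq> 0" "fps_of_poly N = fps_of_poly D * y" "v = Some (fps_to_fls y)"
  shows "v = Some (poly_to_fls N / poly_to_fls D)"
    and "v \<in> Some ` F2q \<longleftrightarrow> D dvd N"
    and "v \<in> Some ` H2_plus_F2q \<longleftrightarrow> (1 - monom 1 1) * D dvd D + (1 - monom 1 1) * N"
proof -
  show v: "v = Some (poly_to_fls N / poly_to_fls D)"
    using assms fps_to_fls_eq_quotient_iff by auto
  show "v \<in> Some ` F2q \<longleftrightarrow> D dvd N"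
    "v \<in> Some ` H2_plus_F2q \<longleftrightarrow> (1 - monom 1 1) * D dvd D + (1 - monom 1 1) * N"
    unfolding quotient_in_F2q_iff[OF assms(1), symmetric]
      quotient_in_H2_plus_F2q_iff[OF assms(1), symmetric] by (auto simp: v)
qed

lemma digits_period:
  "\<forall>a\<in>sset (bs @- cycle cs). 2 \<le> a \<Longrightarrow> cs \<noteq> [] \<Longrightarrow>
    (\<forall>a\<in>set bs. 2 \<le> a) \<and> (\<forall>a\<in>set cs. 2 \<le> (a::nat))"
  by auto

lemma root_lowest_terms_iff:
  assumes "cs \<noteq> []" "\<forall>a\<in>set cs. 2 \<le> a"
  shows "root_lowest_terms cs P Q \<longleftrightarrow>
    coprime P Q \<and> Q \<noteq> 0 \<and> fps_of_poly P = fps_of_poly Q * code_value (cycle cs)"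
  using unit_root_unique[OF assms] unit_root_code_value_cycle[OF assms] fps_to_fls_eq_quotient_iff[of Q]
  unfolding root_lowest_terms_def by metis

text \<open>The terminating and the periodic case differ only in the value of the tail, which is
  $H_2 = 1/(1+q)$ or the unit root of the period.\<close>

lemma test_data_represents:
  assumes "test_data x bs P Q"
  shows "\<exists>y. Delta bs P Q \<noteq> 0 \<and> fps_of_poly (Num bs P Q) = fps_of_poly (Delta bs P Q) * y \<and>
    Phi2 x = Some (fps_to_fls y)"
  using assms unfolding test_data_def
proof (elim disjE exE conjE)
  assume x: "has_code x (Terminating bs)" and "P = 1" "Q = 1 + monom 1 1"
  have Q: "fps_of_poly Q = 1 - fps_X"
    by (simp add: \<open>Q = _\<close> fps_of_poly_hom minus_fps_bit)
  have "(1 - fps_X) * inverse (1 - fps_X) = (1 :: bit fps)" by (intro inverse_mult_eq_1') simp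
  then have "fps_of_poly P = fps_of_poly Q * inverse (1 - fps_X)" by (simp add: \<open>P = 1\<close> Q)
  moreover from this have "Q \<noteq> 0" using \<open>P = 1\<close> by auto
  ultimately show ?thesis
    using Num_Delta[of bs "inverse (1 - fps_X)" Q P] has_code_Terminating[OF x] by auto
next
  fix cs assume cs: "cs \<noteq> []" "root_lowest_terms cs P Q" and x: "has_code x (Infinite (bs @- cycle cs))"
  have dig: "\<forall>a\<in>set bs. 2 \<le> a" "\<forall>a\<in>set cs. 2 \<le> a"
    using digits_period[OF has_code_Infinite(1)[OF x] cs(1)] by auto
  have cyc: "\<forall>a\<in>sset (cycle cs). 2 \<le> a" using dig cs(1) by simp
  show ?thesis
    using Num_Delta[OF dig(1) code_value_nth_0[OF cyc], of Q P] root_lowest_terms_iff[OF cs(1) dig(2)]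
      cs(2) has_code_Infinite(2)[OF x] code_value_shift[OF dig(1) cyc] by auto
qed

lemma test_data_tests:
  assumes "test_data x bs P Q"
  shows "Delta bs P Q \<noteq> 0"
    and "Phi2 x = Some (poly_to_fls (Num bs P Q) / poly_to_fls (Delta bs P Q))"
    and "Phi2 x \<in> Some ` F2q \<longleftrightarrow> Delta bs P Q dvd Num bs P Q"
    and "Phi2 x \<in> Some ` H2_plus_F2q \<longleftrightarrow>
      (1 - monom 1 1) * Delta bs P Q dvd Delta bs P Q + (1 - monom 1 1) * Num bs P Q"
proof -
  obtain y where y: "Delta bs P Q \<noteq> 0"
    "fps_of_poly (Num bs P Q) = fps_of_poly (Delta bs P Q) * y" "Phi2 x = Some (fps_to_fls y)"
    using test_data_represents[OF assms] by blast
  show "Delta bs P Q \<noteq> 0" by (rule y)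
  show "Phi2 x = Some (poly_to_fls (Num bs P Q) / poly_to_fls (Delta bs P Q))"
    "Phi2 x \<in> Some ` F2q \<longleftrightarrow> Delta bs P Q dvd Num bs P Q"
    "Phi2 x \<in> Some ` H2_plus_F2q \<longleftrightarrow>
      (1 - monom 1 1) * Delta bs P Q dvd Delta bs P Q + (1 - monom 1 1) * Num bs P Q"
    using value_tests[OF y] by blast+
qed

lemma period_root:
  assumes "has_code x (Infinite (bs @- cycle cs))" "cs \<noteq> []"
  shows "\<exists>!Y. unit_root cs Y"
    and "period_splits cs \<Longrightarrow> \<exists>P Q. root_lowest_terms cs P Q"
proof -
  have dig: "\<forall>a\<in>set cs. 2 \<le> a"
    using digits_period[OF has_code_Infinite(1)[OF assms(1)] assms(2)] by auto
  show "\<exists>!Y. unit_root cs Y"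
    using unit_root_unique[OF assms(2) dig] unit_root_code_value_cycle[OF assms(2) dig] by blast
  show "\<exists>P Q. root_lowest_terms cs P Q" if "period_splits cs"
    using that rational_fps_lowest_terms
    by (simp add: period_splits_iff_rational[OF assms(2) dig] root_lowest_terms_iff[OF assms(2) dig])
qed

text \<open>Both target sets consist of rational functions, with denominators 1 and $1 - q$.\<close>

lemma tests_exhaustive:
  assumes "x \<in> RC_one" "Phi2 x \<in> Some ` F2q \<or> Phi2 x \<in> Some ` H2_plus_F2q"
  shows "(\<exists>bs. has_code x (Terminating bs)) \<or>
    (\<exists>bs cs. cs \<noteq> [] \<and> has_code x (Infinite (bs @- cycle cs)) \<and> period_splits cs)"
proof -
  obtain w where w: "has_code x w" using RC_one_has_code[OF assms(1)] by blast
  show ?thesis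
  proof (cases w)
    case (Infinite c)
    have x: "has_code x (Infinite c)" using w Infinite by simp
    define v :: "bit poly" where "v = 1 - monom 1 1"
    have "coeff v 0 = 1" by (simp add: v_def)
    then have v: "v \<noteq> 0" by auto
    then have nz: "poly_to_fls v \<noteq> 0" by (auto simp: poly_to_fls_hom)
    have H2: "H2 = 1 / poly_to_fls v" by (simp add: H2_def v_def poly_to_fls_hom del: One_nat_def)
    have "\<exists>P Q. Q \<noteq> 0 \<and> fps_to_fls (code_value c) = poly_to_fls P / poly_to_fls Q"
      using assms(2) unfolding has_code_Infinite(2)[OF x]
    proof
      assume "Some (fps_to_fls (code_value c)) \<in> Some ` F2q"
      then obtain p where "fps_to_fls (code_value c) = poly_to_fls p / poly_to_fls 1"
        by (auto simp: F2q_def poly_to_fls_hom)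
      then show ?thesis using one_neq_zero by blast
    next
      assume "Some (fps_to_fls (code_value c)) \<in> Some ` H2_plus_F2q"
      then obtain p where "fps_to_fls (code_value c) = H2 + poly_to_fls p"
        by (auto simp: F2q_def H2_plus_F2q_def)
      then have "fps_to_fls (code_value c) = poly_to_fls (1 + v * p) / poly_to_fls v"
        using nz by (simp add: H2 poly_to_fls_hom field_simps)
      then show ?thesis using v by blast
    qed
    then have "rational_fps (code_value c)" 
      unfolding rational_fps_def using fps_to_fls_eq_quotient_iff by blast
    then show ?thesis
      using rational_fps_eventually_periodic[OF _ has_code_Infinite(1)[OF x]] x by blast
  qed (use w in blast)
qed

lemma criteria_iff:
  assumes "x \<in> RC_one"
  shows "criterion_a x \<longleftrightarrow> Phi2 x \<in> Some ` F2q"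
    and "criterion_b x \<longleftrightarrow> Phi2 x \<in> Some ` H2_plus_F2q"
proof -
  have ex: "\<exists>bs P Q. test_data x bs P Q"
    if "Phi2 x \<in> Some ` F2q \<or> Phi2 x \<in> Some ` H2_plus_F2q"
    using tests_exhaustive[OF assms that]
  proof (elim disjE exE conjE)
    fix bs assume "has_code x (Terminating bs)"
    then show ?thesis unfolding test_data_def by blast
  next
    fix bs cs assume "cs \<noteq> []" "has_code x (Infinite (bs @- cycle cs))" "period_splits cs"
    then show ?thesis using period_root(2) unfolding test_data_def by blast
  qed
  show "criterion_a x \<longleftrightarrow> Phi2 x \<in> Some ` F2q"
    using ex test_data_tests(3) unfolding criterion_a_def by blast
  show "criterion_b x \<longleftrightarrow> Phi2 x \<in> Some ` H2_plus_F2q"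
    using ex test_data_tests(4) unfolding criterion_b_def by blast
qed

section \<open>Integer translation and the nonnegative part of the line\<close>

lemma F2q_iff_even: "fps_to_fls (fps_mod2 g) \<in> F2q \<longleftrightarrow> (\<forall>\<^sub>F j in sequentially. even (g $ j))"
  and H2_plus_F2q_iff_odd:
    "fps_to_fls (fps_mod2 g) \<in> H2_plus_F2q \<longleftrightarrow> (\<forall>\<^sub>F j in sequentially. odd (g $ j))"
  unfolding fps_to_fls_in_F2q_iff fps_to_fls_in_H2_plus_F2q_iff fps_mod2_nth of_int_bit_eq_iff
  by (rule refl)+

text \<open>The map $g \mapsto q g + 1$ of the translation rule, whose inverse on series with constant term 1
  stays within power series.\<close>

definition q_up :: "int fps \<Rightarrow> int fps" where
  "q_up g = 1 + fps_X * g"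

lemma q_up_shift: "g $ 0 = 1 \<Longrightarrow> q_up (fps_shift 1 g) = g"
  by (intro fps_ext) (auto simp: q_up_def fps_X_mult_nth)

lemma q_down_fps_to_fls:
  assumes "g $ 0 = 1"
  shows "q_down (fps_to_fls g) = fps_to_fls (fps_shift 1 g)"
proof -
  have "q_down (fps_to_fls g) = fls_X_inv * (fls_X * fps_to_fls (fps_shift 1 g))"
    unfolding q_down_def
    by (subst q_up_shift[OF assms, symmetric]) (simp add: q_up_def fls_times_fps_to_fls)
  also have "\<dots> = fps_to_fls (fps_shift 1 g)"
    by (simp add: fls_X_inv_times_conv_shift fls_X_times_conv_shift)
  finally show ?thesis .
qed

text \<open>Passing from $[x]_q$ to $[x+1]_q = q[x]_q + 1$ shifts the coefficients by one place, which
  does not affect what they eventually do. This is why the criteria may be applied to $x + 1$.\<close>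

lemma eventually_even_q_up:
  "(\<forall>\<^sub>F j in sequentially. even (q_up g $ j)) \<longleftrightarrow> (\<forall>\<^sub>F j in sequentially. even (g $ j))"
  by (subst eventually_sequentially_Suc[symmetric]) (simp add: q_up_def)

lemma eventually_odd_q_up:
  "(\<forall>\<^sub>F j in sequentially. odd (q_up g $ j)) \<longleftrightarrow> (\<forall>\<^sub>F j in sequentially. odd (g $ j))"
  by (subst eventually_sequentially_Suc[symmetric]) (simp add: q_up_def)

lemmas parity_simps = F2q_iff_even H2_plus_F2q_iff_odd eventually_even_q_up eventually_odd_q_up

lemma q_real_nonneg:
  assumes "0 \<le> x"
  shows "\<exists>g. q_real x = fps_to_fls g \<and> (x < 1 \<longrightarrow> q_real (x + 1) = fps_to_fls (q_up g))"
proof (cases "x < 1")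
  case False
  then show ?thesis using q_real_ge1_iff[of x] by auto
next
  case True
  obtain c where c: "infinite_expansion (x + 1) c" using infinite_expansion_exists[of "x + 1"] assms by auto
  define g where "g = q_cf_limit c"
  have g0: "g $ 0 = 1" using c by (simp add: g_def q_cf_limit_nth_0 infinite_expansion_def)
  have x1: "q_real (x + 1) = fps_to_fls g"
    using assms c by (simp add: q_real_ge1_iff q_real_ge1_eq g_def)
  have "\<lfloor>x\<rfloor> = 0" using True assms by (simp add: floor_eq_iff)
  then have "q_real x = q_down (fps_to_fls g)"
    using c by (simp add: q_real_def Let_def q_real_ge1_eq g_def)
  then have "q_real x = fps_to_fls (fps_shift 1 g)" by (simp add: q_down_fps_to_fls g0)
  then show ?thesis using x1 q_up_shift[OF g0] by metis
qed

lemma q_rat_minus_pos: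
  assumes "0 < r"
  shows "\<exists>g. q_rat_minus r = fps_to_fls g \<and> (r \<le> 1 \<longrightarrow> q_rat_minus (r + 1) = fps_to_fls (q_up g))"
proof (cases "r \<le> 1")
  case False
  then show ?thesis using q_rat_minus_gt1_iff[of r] by auto
next
  case True
  obtain cs where cs: "finite_expansion (r + 1) cs" using finite_expansion_exists[of "r + 1"] assms by auto
  define g where "g = q_cf q_last_minus cs"
  have g0: "g $ 0 = 1" unfolding g_def using cs
    by (intro q_cf_nth_0) (auto simp: finite_expansion_def q_last_minus_def coeff_q_int fps_X_power_mult_nth)
  have x1: "q_rat_minus (r + 1) = fps_to_fls g"
    using assms cs by (simp add: q_rat_minus_gt1_iff q_rat_minus_gt1_eq g_def)
  have "\<lceil>r\<rceil> = 1" using True assms by (simp add: ceiling_eq_iff)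
  then have "q_rat_minus r = q_down (fps_to_fls g)"
    using cs by (simp add: q_rat_minus_def Let_def q_rat_minus_gt1_eq g_def)
  then have "q_rat_minus r = fps_to_fls (fps_shift 1 g)" by (simp add: q_down_fps_to_fls g0)
  then show ?thesis using x1 q_up_shift[OF g0] by metis
qed

lemma cantor_of_real_of_rat: "cantor_of_real (of_rat r) = RatPlus r"
  by (simp add: cantor_of_real_def)

lemma cantor_of_real_irrational: "cantor_of_real (real_of_irrational y) = Irr y"
  using real_of_irrational[of y] by (simp add: cantor_of_real_def real_of_irrational_inverse)

lemma real_of_irrational_neq_1: "real_of_irrational y \<noteq> 1"
  using of_rat_neq_irrational[of 1 y] by simp

lemma real_cases:
  obtains r where "x = of_rat r" | y where "x = real_of_irrational y"
  using Irrational_inverse[of x] by (cases "x \<in> \<rat>") (auto elim!: Rats_cases intro: that, metis)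

lemma Phi2_cantor_of_real: "Phi2 (cantor_of_real x) = Some (fls_mod2 (q_real x))"
  by (cases x rule: real_cases) (simp_all add: cantor_of_real_of_rat cantor_of_real_irrational)

lemma cantor_of_real_in_RC_one: "1 \<le> x \<Longrightarrow> cantor_of_real x \<in> RC_one"
  by (cases x rule: real_cases)
    (auto simp: cantor_of_real_of_rat cantor_of_real_irrational RC_one_def less_eq_cantor_line_def
      one_ereal_def real_of_irrational_neq_1 less_le)

lemma translate_cantor_of_real: "translate 1 (cantor_of_real x) = cantor_of_real (x + 1)"
proof (cases x rule: real_cases)
  case (1 r)
  then have "x + 1 = of_rat (r + 1)" by (simp add: of_rat_add)
  then show ?thesis using 1 by (simp only: cantor_of_real_of_rat) simp
next
  case (2 y)
  have "real_of_irrational y + 1 \<notin> \<rat>"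
    using real_of_irrational[of y] Rats_diff[of "real_of_irrational y + 1" 1] by auto
  then have "x + 1 = real_of_irrational (Irrational (real_of_irrational y + 1))"
    using 2 by (simp add: Irrational_inverse)
  then have "cantor_of_real (x + 1) = Irr (Irrational (real_of_irrational y + 1))"
    using cantor_of_real_irrational by metis
  then show ?thesis using 2 by (simp add: cantor_of_real_irrational)
qed

lemma RatMinus_in_RC_one: "RatMinus r \<in> RC_one \<longleftrightarrow> 1 < r"
  by (auto simp: RC_one_def less_eq_cantor_line_def one_ereal_def)

lemma RatMinus_in_RC_plus: "RatMinus r \<in> RC_plus \<longleftrightarrow> 0 < r"
  by (auto simp: RC_plus_def less_eq_cantor_line_def zero_ereal_def)

lemma RC_plus_cases:
  assumes "x \<in> RC_plus - RC_one"
  obtains u where "x = cantor_of_real u" "0 \<le> u" "u < 1" | r where "x = RatMinus r" "0 < r" "r \<le> 1"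
proof (cases x)
  case (Irr y)
  then have "0 \<le> real_of_irrational y" "real_of_irrational y < 1"
    using assms real_of_irrational_neq_1[of y] by (auto simp: RC_plus_def RC_one_def less_eq_cantor_line_def zero_ereal_def one_ereal_def)
  then show ?thesis using that(1)[of "real_of_irrational y"] Irr by (simp add: cantor_of_real_irrational)
next
  case (RatPlus r)
  then have "0 \<le> r" "r < 1"
    using assms by (auto simp: RC_plus_def RC_one_def less_eq_cantor_line_def zero_ereal_def one_ereal_def)
  then show ?thesis using that(1)[of "of_rat r"] RatPlus by (simp add: cantor_of_real_of_rat)
next
  case (RatMinus r)
  then show ?thesis using that(2)[of r] assms RatMinus_in_RC_one[of r] RatMinus_in_RC_plus[of r] by auto
qed (use assms in \<open>auto simp: RC_plus_def RC_one_def less_eq_cantor_line_def\<close>)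

lemma translation_invariance:
  assumes "x \<in> RC_plus - RC_one"
  shows "translate 1 x \<in> RC_one"
    and "Phi2 x \<in> Some ` F2q \<longleftrightarrow> Phi2 (translate 1 x) \<in> Some ` F2q"
    and "Phi2 x \<in> Some ` H2_plus_F2q \<longleftrightarrow> Phi2 (translate 1 x) \<in> Some ` H2_plus_F2q"
proof -
  have inj: "Some v \<in> Some ` S \<longleftrightarrow> v \<in> S" for v :: "bit fls" and S by auto
  have "translate 1 x \<in> RC_one \<and> (\<exists>g. Phi2 x = Some (fps_to_fls (fps_mod2 g)) \<and>
      Phi2 (translate 1 x) = Some (fps_to_fls (fps_mod2 (q_up g))))"
    using assms
  proof (cases rule: RC_plus_cases)
    case (1 u)
    then show ?thesis using q_real_nonneg[of u] cantor_of_real_in_RC_one[of "u + 1"]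
      by (auto simp: translate_cantor_of_real Phi2_cantor_of_real fls_mod2_fps_to_fls)
  next
    case (2 r)
    then show ?thesis using q_rat_minus_pos[of r]
      by (auto simp: RatMinus_in_RC_one fls_mod2_fps_to_fls)
  qed
  then show "translate 1 x \<in> RC_one"
    and "Phi2 x \<in> Some ` F2q \<longleftrightarrow> Phi2 (translate 1 x) \<in> Some ` F2q"
    and "Phi2 x \<in> Some ` H2_plus_F2q \<longleftrightarrow> Phi2 (translate 1 x) \<in> Some ` H2_plus_F2q"
    by (auto simp: inj parity_simps)
qed

lemma parity_criteria:
  assumes "y \<in> RC_one" "Phi2 y = Some (fps_to_fls (fps_mod2 g)) \<or>
      Phi2 y = Some (fps_to_fls (fps_mod2 (q_up g)))"
  shows "(\<forall>\<^sub>F j in sequentially. even (g $ j)) \<longleftrightarrow> criterion_a y"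
    and "(\<forall>\<^sub>F j in sequentially. odd (g $ j)) \<longleftrightarrow> criterion_b y"
proof -
  have inj: "Some v \<in> Some ` S \<longleftrightarrow> v \<in> S" for v :: "bit fls" and S by auto
  show "(\<forall>\<^sub>F j in sequentially. even (g $ j)) \<longleftrightarrow> criterion_a y"
    and "(\<forall>\<^sub>F j in sequentially. odd (g $ j)) \<longleftrightarrow> criterion_b y"
    using assms(2) unfolding criteria_iff[OF assms(1)] by (auto simp: inj parity_simps)
qed

lemma parity_criteria_real:
  assumes "0 \<le> x"
  defines "y \<equiv> if x < 1 then translate 1 (cantor_of_real x) else cantor_of_real x"
  shows "\<exists>\<gamma> :: nat \<Rightarrow> int. q_real x = fps_to_fls (Abs_fps \<gamma>) \<and>
    ((\<forall>\<^sub>F j in sequentially. even (\<gamma> j)) \<longleftrightarrow> criterion_a y) \<and>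
    ((\<forall>\<^sub>F j in sequentially. odd (\<gamma> j)) \<longleftrightarrow> criterion_b y)"
proof -
  obtain g where g: "q_real x = fps_to_fls g" "x < 1 \<longrightarrow> q_real (x + 1) = fps_to_fls (q_up g)"
    using q_real_nonneg[OF assms(1)] by blast
  have "y \<in> RC_one"
    using assms(1) cantor_of_real_in_RC_one by (simp add: y_def translate_cantor_of_real)
  moreover have "Phi2 y = Some (fps_to_fls (fps_mod2 g)) \<or>
      Phi2 y = Some (fps_to_fls (fps_mod2 (q_up g)))"
    using g by (auto simp: y_def translate_cantor_of_real Phi2_cantor_of_real fls_mod2_fps_to_fls)
  ultimately show ?thesis
    using g(1) parity_criteria[of y g] by (intro exI[of _ "fps_nth g"]) (simp add: fps_nth_inverse)
qed

lemma parity_criteria_rat_minus: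
  assumes "RatMinus r \<in> RC_plus"
  defines "y \<equiv> if RatMinus r \<in> RC_one then RatMinus r else translate 1 (RatMinus r)"
  shows "\<exists>\<gamma> :: nat \<Rightarrow> int. q_rat_minus r = fps_to_fls (Abs_fps \<gamma>) \<and>
    ((\<forall>\<^sub>F j in sequentially. even (\<gamma> j)) \<longleftrightarrow> criterion_a y) \<and>
    ((\<forall>\<^sub>F j in sequentially. odd (\<gamma> j)) \<longleftrightarrow> criterion_b y)"
proof -
  have "0 < r" using assms(1) by (simp add: RatMinus_in_RC_plus)
  then obtain g where g: "q_rat_minus r = fps_to_fls g"
    "r \<le> 1 \<longrightarrow> q_rat_minus (r + 1) = fps_to_fls (q_up g)"
    using q_rat_minus_pos by blast
  have "y \<in> RC_one" using \<open>0 < r\<close> by (simp add: y_def RatMinus_in_RC_one)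
  moreover have "Phi2 y = Some (fps_to_fls (fps_mod2 g)) \<or>
      Phi2 y = Some (fps_to_fls (fps_mod2 (q_up g)))"
    using g by (auto simp: y_def RatMinus_in_RC_one fls_mod2_fps_to_fls)
  ultimately show ?thesis
    using g(1) parity_criteria[of y g] by (intro exI[of _ "fps_nth g"]) (simp add: fps_nth_inverse)
qed

section \<open>The criteria\<close>

lemma periodic_code_tests:
  assumes "has_code x (Infinite (bs @- cycle cs))" "cs \<noteq> []" "period_splits cs"
    "root_lowest_terms cs P Q"
  shows "Delta bs P Q \<noteq> 0 \<and>
    Phi2 x = Some (poly_to_fls (Num bs P Q) / poly_to_fls (Delta bs P Q)) \<and>
    (Phi2 x \<in> Some ` F2q \<longleftrightarrow> Delta bs P Q dvd Num bs P Q) \<and>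
    (Phi2 x \<in> Some ` H2_plus_F2q \<longleftrightarrow>
      (1 - monom 1 1) * Delta bs P Q dvd Delta bs P Q + (1 - monom 1 1) * Num bs P Q)"
proof -
  have "test_data x bs P Q" unfolding test_data_def using assms by blast
  then show ?thesis using test_data_tests by blast
qed

lemma terminating_code_tests:
  assumes "has_code x (Terminating bs)" "P = 1" "Q = 1 + monom 1 1"
  shows "Delta bs P Q \<noteq> 0 \<and>
    Phi2 x = Some (poly_to_fls (Num bs P Q) / poly_to_fls (Delta bs P Q)) \<and>
    (Phi2 x \<in> Some ` F2q \<longleftrightarrow> Delta bs P Q dvd Num bs P Q) \<and>
    (Phi2 x \<in> Some ` H2_plus_F2q \<longleftrightarrow>
      (1 - monom 1 1) * Delta bs P Q dvd Delta bs P Q + (1 - monom 1 1) * Num bs P Q)"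
proof -
  have "test_data x bs P Q" unfolding test_data_def using assms by blast
  then show ?thesis using test_data_tests by blast
qed

lemma periodic_code_splits_iff:
  assumes "has_code x (Infinite (bs @- cycle cs))" "cs \<noteq> []"
  shows "period_splits cs \<longleftrightarrow>
    to_F2_q (mB cs * mC cs) / to_F2_q ((mA cs + mD cs)\<^sup>2) \<in> {u\<^sup>2 + u | u. True}"
  using digits_period[OF has_code_Infinite(1)[OF assms(1)] assms(2)]
    period_splits_iff_Artin_Schreier[OF assms(2)] by blast

unbundle vec_syntax

theorem corollary8p6:
  shows
   "(\<forall>x \<in> RC_one. \<forall>bs cs. cs \<noteq> [] \<and> has_code x (Infinite (bs @- cycle cs)) \<longrightarrow>
       (let A = Mprod cs $ 1 $ 1; B = Mprod cs $ 1 $ 2;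
            C = Mprod cs $ 2 $ 1; D = Mprod cs $ 2 $ 2
        in period_splits cs \<longleftrightarrow>
           to_F2_q (B * C) / to_F2_q ((A + D)\<^sup>2) \<in> {u\<^sup>2 + u | u. True}) \<and>
       (period_splits cs \<longrightarrow>
          (\<exists>!Y. unit_root cs Y) \<and>
          (\<exists>P Q. root_lowest_terms cs P Q) \<and>
          (\<forall>P Q. root_lowest_terms cs P Q \<longrightarrow>
             Delta bs P Q \<noteq> 0 \<and>
             Phi2 x = Some (poly_to_fls (Num bs P Q) / poly_to_fls (Delta bs P Q)) \<and>
             (Phi2 x \<in> Some ` F2q \<longleftrightarrow> Delta bs P Q dvd Num bs P Q) \<and>
             (Phi2 x \<in> Some ` H2_plus_F2q \<longleftrightarrow>
                (1 - monom 1 1) * Delta bs P Q dvd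
                  Delta bs P Q + (1 - monom 1 1) * Num bs P Q)))) \<and>
    (\<forall>x \<in> RC_one. \<forall>bs P Q. has_code x (Terminating bs) \<and> P = 1 \<and> Q = 1 + monom 1 1 \<longrightarrow>
       Delta bs P Q \<noteq> 0 \<and>
       Phi2 x = Some (poly_to_fls (Num bs P Q) / poly_to_fls (Delta bs P Q)) \<and>
       (Phi2 x \<in> Some ` F2q \<longleftrightarrow> Delta bs P Q dvd Num bs P Q) \<and>
       (Phi2 x \<in> Some ` H2_plus_F2q \<longleftrightarrow>
          (1 - monom 1 1) * Delta bs P Q dvd
            Delta bs P Q + (1 - monom 1 1) * Num bs P Q)) \<and>
    (\<forall>x \<in> RC_one. Phi2 x \<in> Some ` F2q \<or> Phi2 x \<in> Some ` H2_plus_F2q \<longrightarrow>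
       (\<exists>bs. has_code x (Terminating bs)) \<or>
       (\<exists>bs cs. cs \<noteq> [] \<and> has_code x (Infinite (bs @- cycle cs)) \<and> period_splits cs)) \<and>
    (\<forall>x \<in> RC_plus - RC_one.
       translate 1 x \<in> RC_one \<and>
       (Phi2 x \<in> Some ` F2q \<longleftrightarrow> Phi2 (translate 1 x) \<in> Some ` F2q) \<and>
       (Phi2 x \<in> Some ` H2_plus_F2q \<longleftrightarrow> Phi2 (translate 1 x) \<in> Some ` H2_plus_F2q)) \<and>
    (\<forall>x::real. 0 \<le> x \<longrightarrow>
       (let y = (if x < 1 then translate 1 (cantor_of_real x) else cantor_of_real x) in
        \<exists>\<gamma> :: nat \<Rightarrow> int.
          q_real x = fps_to_fls (Abs_fps \<gamma>) \<and>
          ((\<forall>\<^sub>F j in sequentially. even (\<gamma> j)) \<longleftrightarrow> criterion_a y) \<and>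
          ((\<forall>\<^sub>F j in sequentially. odd (\<gamma> j)) \<longleftrightarrow> criterion_b y))) \<and>
    (\<forall>r. RatMinus r \<in> RC_plus \<longrightarrow>
       (let y = (if RatMinus r \<in> RC_one then RatMinus r else translate 1 (RatMinus r)) in
        \<exists>\<gamma> :: nat \<Rightarrow> int.
          q_rat_minus r = fps_to_fls (Abs_fps \<gamma>) \<and>
          ((\<forall>\<^sub>F j in sequentially. even (\<gamma> j)) \<longleftrightarrow> criterion_a y) \<and>
          ((\<forall>\<^sub>F j in sequentially. odd (\<gamma> j)) \<longleftrightarrow> criterion_b y)))"
proof -
  show ?thesis
    unfolding Let_def
  proof (intro conjI ballI allI impI, goal_cases)
    case (1 x bs cs)
    then show ?case using periodic_code_splits_iff by blast
  next
    case (2 x bs cs)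
    then show ?case using period_root(1) by blast
  next
    case (3 x bs cs)
    then show ?case using period_root(2) by blast
  next
    case (4 x bs cs P Q)
    then show ?case using periodic_code_tests by blast
  next
    case (5 x bs cs P Q)
    then show ?case using periodic_code_tests by blast
  next
    case (6 x bs cs P Q)
    then show ?case using periodic_code_tests by blast
  next
    case (7 x bs cs P Q)
    then show ?case using periodic_code_tests by blast
  next
    case (8 x bs P Q)
    then show ?case using terminating_code_tests by blast
  next
    case (9 x bs P Q)
    then show ?case using terminating_code_tests by blast
  next
    case (10 x bs P Q)
    then show ?case using terminating_code_tests by blast
  next
    case (11 x bs P Q)
    then show ?case using terminating_code_tests by blast
  next
    case (12 x)
    then show ?case by (rule tests_exhaustive)
  next
    case (13 x)
    then show ?case by (rule translation_invariance)
  next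
    case (14 x)
    then show ?case by (rule translation_invariance)
  next
    case (15 x)
    then show ?case by (rule translation_invariance)
  next
    case (16 x)
    then show ?case by (rule parity_criteria_real)
  next
    case (17 r)
    then show ?case by (rule parity_criteria_rat_minus)
  qed
qed

end
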